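(* Let $\alpha=2$, $c=0$ and $\eta=\infty$. In the Rayleigh fading model, the local transmission capacity gain of FH-CDMA over DS-CDMA at the origin $o$ is $$\frac{c^{\mathrm{FH}}(o,\epsilon)}{c^{\mathrm{DS}}(o,\epsilon)}=1+\frac{F(0)}{A_2(o,\beta d^2)}\log M+O(1),$$ where $M$ is the processing gain and $A_2(o,\cdot)$ is the functional of the shape function $F$ given in the context.
   Context: $\Phi$ is an isotropic Poisson point process on $\mathbb{R}^2$ with intensity function $\lambda F(\|x\|)$, where $0<\lambda<\infty$ is a constant and $F:[0,\infty)\to[0,1]$ is the shape function; $f(r)=\mathrm dF(r)/\mathrm dr$. The reference receiver is at the origin $o$, and a reference transmitter $x_0$, not part of $\Phi$, is at distance $d$ from it. The power fading coefficients $\mathsf g_{\mathsf x}$ ($\mathsf x\in\Phi$) and $\mathsf g_{x_0}$ are i.i.d. and independent of $\Phi$; Rayleigh fading means that they are exponentially distributed with mean $1$. The path loss function is $\ell(r)=(c+r^{\alpha})^{-1}$, the interference is $\mathsf I(o)=\sum_{\mathsf x\in\Phi}\mathsf g_{\mathsf x}\,\ell(\|\mathsf x\|)$, and $\mathtt{SINR}(o)=\mathsf g_{x_0}/\big(\frac1\eta+\ell(d)^{-1}\mathsf I(o)\big)$, where $\eta$ is the average signal-to-noise ratio ($\eta=\infty$: no noise). The outage probability is $\mathtt P_{\mathrm o}(o)=\mathbb{P}(\mathtt{SINR}(o)<\beta)$ with threshold $\beta$. The local transmission capacity at $x$ is $c(x,\epsilon)=\lambda(x,\epsilon)(1-\epsilon)$,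 where $\lambda(x,\epsilon)$ is the maximal density of concurrent transmissions in an infinitesimal region around $x$ subject to an outage probability constraint $\epsilon$; it is computed by solving $\mathtt P_{\mathrm o}(x)=\epsilon$ for $\lambda$. $c^{\mathrm{FH}}$ and $c^{\mathrm{DS}}$ are the local transmission capacities for frequency-hopping and direct-sequence CDMA with processing gain $M$: FH thins the interferer process by $M$ ($\lambda$ is replaced by $\lambda/M$ in the outage probability), DS reduces the interference by a factor $M$ ($\beta$ is replaced by $\beta/M$). $O(1)$ refers to the dependence on $M$. $A_2(o,u)$ is obtained from $$A_2(y_0,u)=-\pi\left(F(0)\,\operatorname{asinh}\frac{u-\|y_0\|^2}{2\|y_0\|\sqrt u}+\int_0^\infty f(r)\,\operatorname{asinh}\frac{r^2+u-\|y_0\|^2}{2\|y_0\|\sqrt u}\,\mathrm dr\right)$$ (defined for $\|y_0\|>0$) by replacing the $\operatorname{asinh}$ terms by $\log(r^2+u)$ (with $r=0$ in the first term), i.e. $A_2(o,u)=-\pi\big(F(0)\log u+\int_0^\infty f(r)\log(r^2+u)\,\mathrm dr\big)$.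
   Formalization: The coefficient of log M is corrected from F(0)/A_2 to πF(0)/A_2 (the printed formula fails, e.g. for F(r)=exp(-r²)); F is assumed differentiable on [0,∞), not identically 0 and vanishing at infinity, with the integral in A_2(o,βd²) absolutely convergent. *)

theory Defs
  imports "HOL-Probability.Probability" "HOL-Library.Landau_Symbols"
begin

text \<open>
  A point process is given by an enumeration of its points: \<open>K\<close> is the (possibly infinite) number
  of points and the points are \<open>X n\<close> for \<open>n < K\<close>.  The variables \<open>X n\<close> with \<open>n \<ge> K\<close> are not used.
\<close>

definition num_points :: "('w \<Rightarrow> enat) \<Rightarrow> (nat \<Rightarrow> 'w \<Rightarrow> 'a) \<Rightarrow> 'a set \<Rightarrow> 'w \<Rightarrow> ennreal" where
  "num_points K X B \<omega> = (\<Sum>n. if enat n < K \<omega> then indicator B (X n \<omega>) else 0)"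

locale poisson_point_process = prob_space \<Omega>
  for \<Omega> :: "'w measure" +
  fixes \<Lambda> :: "'a::euclidean_space measure"
    and K :: "'w \<Rightarrow> enat"
    and X :: "nat \<Rightarrow> 'w \<Rightarrow> 'a"
  assumes sets_intensity: "sets \<Lambda> = sets borel"
    and measurable_K: "K \<in> \<Omega> \<rightarrow>\<^sub>M count_space UNIV"
    and measurable_X: "\<And>n. X n \<in> \<Omega> \<rightarrow>\<^sub>M borel"
    and poisson_count: "\<And>B k. B \<in> sets borel \<Longrightarrow> emeasure \<Lambda> B < \<infinity> \<Longrightarrow>
      prob {\<omega> \<in> space \<Omega>. num_points K X B \<omega> = of_nat k}
        = measure \<Lambda> B ^ k / fact k * exp (- measure \<Lambda> B)"
    and indep_count: "\<And>(I :: nat set) B. finite I \<Longrightarrow> (\<And>i. i \<in> I \<Longrightarrow> B i \<in> sets borel) \<Longrightarrow>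
      disjoint_family_on B I \<Longrightarrow> indep_vars (\<lambda>_. borel) (\<lambda>i. num_points K X (B i)) I"

text \<open>
  The fading coefficient of the point \<open>X n\<close> is \<open>g n\<close>, and \<open>g\<^sub>0\<close> is the one of the reference
  transmitter, which is not a point of the process.
\<close>

locale rayleigh_network = poisson_point_process \<Omega> \<Lambda> K X
  for \<Omega> :: "'w measure" and \<Lambda> :: "'a::euclidean_space measure" and K X +
  fixes g :: "nat \<Rightarrow> 'w \<Rightarrow> real"
    and g\<^sub>0 :: "'w \<Rightarrow> real"
  assumes exponential_g: "\<And>n. distributed \<Omega> lborel (g n) (exponential_density 1)"
    and exponential_g0: "distributed \<Omega> lborel g\<^sub>0 (exponential_density 1)"
    and indep_fading: "indep_vars (\<lambda>_. borel) (case_option g\<^sub>0 g) (UNIV :: nat option set)"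
    and indep_fading_points: "indep_set
      (sets (vimage_algebra (space \<Omega>) (\<lambda>\<omega>. (g\<^sub>0 \<omega>, \<lambda>n. g n \<omega>))
        (borel \<Otimes>\<^sub>M (\<Pi>\<^sub>M n\<in>UNIV. borel))))
      (sets (vimage_algebra (space \<Omega>) (\<lambda>\<omega>. (K \<omega>, \<lambda>n. X n \<omega>))
        (count_space UNIV \<Otimes>\<^sub>M (\<Pi>\<^sub>M n\<in>UNIV. borel))))"

definition isotropic_intensity :: "real \<Rightarrow> (real \<Rightarrow> real) \<Rightarrow> (real^2) measure" where
  "isotropic_intensity l F = density lborel (\<lambda>x. ennreal (l * F (norm x)))"

text \<open>
  The path loss, the interference and the SINR take values in \<open>[0, \<infinity>]\<close>: the path loss is infinite
  at \<open>r = 0\<close> if \<open>c = 0\<close>, \<open>\<eta> = \<infinity>\<close> gives \<open>1 / \<eta> = 0\<close>, and without noise the SINR is infinite if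
  there is no interferer.
\<close>

definition path_loss :: "real \<Rightarrow> real \<Rightarrow> real \<Rightarrow> ennreal" where
  "path_loss c \<alpha> r = inverse (ennreal (c + r powr \<alpha>))"

definition interference ::
  "real \<Rightarrow> real \<Rightarrow> ('w \<Rightarrow> enat) \<Rightarrow> (nat \<Rightarrow> 'w \<Rightarrow> 'a::real_normed_vector) \<Rightarrow> (nat \<Rightarrow> 'w \<Rightarrow> real) \<Rightarrow> 'w \<Rightarrow> ennreal" where
  "interference c \<alpha> K X g \<omega> =
    (\<Sum>n. if enat n < K \<omega> then ennreal (g n \<omega>) * path_loss c \<alpha> (norm (X n \<omega>)) else 0)"

definition sinr ::
  "real \<Rightarrow> real \<Rightarrow> ennreal \<Rightarrow> real \<Rightarrow> ('w \<Rightarrow> enat) \<Rightarrow> (nat \<Rightarrow> 'w \<Rightarrow> 'a::real_normed_vector) \<Rightarrow>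
    (nat \<Rightarrow> 'w \<Rightarrow> real) \<Rightarrow> ('w \<Rightarrow> real) \<Rightarrow> 'w \<Rightarrow> ennreal" where
  "sinr c \<alpha> \<eta> d K X g g\<^sub>0 \<omega> =
    ennreal (g\<^sub>0 \<omega>) / (1 / \<eta> + inverse (path_loss c \<alpha> d) * interference c \<alpha> K X g \<omega>)"

definition outage_probability ::
  "'w measure \<Rightarrow> real \<Rightarrow> real \<Rightarrow> ennreal \<Rightarrow> real \<Rightarrow> ('w \<Rightarrow> enat) \<Rightarrow> (nat \<Rightarrow> 'w \<Rightarrow> 'a::real_normed_vector) \<Rightarrow>
    (nat \<Rightarrow> 'w \<Rightarrow> real) \<Rightarrow> ('w \<Rightarrow> real) \<Rightarrow> real \<Rightarrow> real" where
  "outage_probability \<Omega> c \<alpha> \<eta> d K X g g\<^sub>0 \<beta> =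
    measure \<Omega> {\<omega> \<in> space \<Omega>. sinr c \<alpha> \<eta> d K X g g\<^sub>0 \<omega> < ennreal \<beta>}"

text \<open>
  The argument \<open>P\<close> is the outage probability as a function of the density \<open>\<lambda>\<close>; if it is continuous
  and strictly increasing, the maximal density is the solution of \<open>P \<lambda> = \<epsilon>\<close>.
\<close>

definition max_density :: "(real \<Rightarrow> real) \<Rightarrow> real \<Rightarrow> real" where
  "max_density P \<epsilon> = (GREATEST l. 0 < l \<and> P l \<le> \<epsilon>)"

definition local_capacity :: "(real \<Rightarrow> real) \<Rightarrow> real \<Rightarrow> real" where
  "local_capacity P \<epsilon> = max_density P \<epsilon> * (1 - \<epsilon>)"

text \<open>Here \<open>P l \<beta>\<close> is the outage probability for density \<open>l\<close> and threshold \<open>\<beta>\<close>.\<close>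

definition capacity_FH :: "(real \<Rightarrow> real \<Rightarrow> real) \<Rightarrow> real \<Rightarrow> real \<Rightarrow> real \<Rightarrow> real" where
  "capacity_FH P \<beta> M \<epsilon> = local_capacity (\<lambda>l. P (l / M) \<beta>) \<epsilon>"

definition capacity_DS :: "(real \<Rightarrow> real \<Rightarrow> real) \<Rightarrow> real \<Rightarrow> real \<Rightarrow> real \<Rightarrow> real" where
  "capacity_DS P \<beta> M \<epsilon> = local_capacity (\<lambda>l. P l (\<beta> / M)) \<epsilon>"

text \<open>
  For a differentiable shape function \<open>F\<close> with derivative \<open>f\<close> that vanishes at infinity,
  integration by parts gives \<open>A2_origin F f u = \<integral> F (norm x) / ((norm x)\<^sup>2 + u) dx\<close> over the plane,
  which behaves like \<open>- pi * F 0 * ln u\<close> as \<open>u\<close> tends to 0.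
\<close>

definition A2_origin :: "(real \<Rightarrow> real) \<Rightarrow> (real \<Rightarrow> real) \<Rightarrow> real \<Rightarrow> real" where
  "A2_origin F f u = - pi * (F 0 * ln u + (LBINT r:{0..}. f r * ln (r\<^sup>2 + u)))"

end

theory Submission
  imports Defs
begin

text \<open>
  Conditionally on the points, the exponential fading makes the success probability a product of
  factors \<open>1 / (1 + a (X n))\<close>; the Laplace functional of the Poisson process then gives
  the outage probability \<open>1 - exp (- l * pi * s * J s)\<close> with \<open>s = b * d\<^sup>2\<close> and
  \<open>J s = \<integral> F r * 2 r / (r\<^sup>2 + s) dr\<close>.  Solving for the density, the capacity gain is
  \<open>J (u / M) / J u\<close> with \<open>u = \<beta> * d\<^sup>2\<close>.  Integration by parts identifies \<open>pi * J u\<close> with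
  \<open>A2_origin F f u\<close>, and since \<open>F\<close> is Lipschitz at 0, \<open>J v = - F 0 * ln v + O(1)\<close> as \<open>v\<close>
  tends to 0.
\<close>

subsection \<open>The Laplace functional of a Poisson point process\<close>

text \<open>With \<open>c = 0\<close> the path loss is unbounded near the origin, and a sum over
  infinitely many points may diverge. The probabilistic part therefore runs in
  \<open>ennreal\<close> with \<open>exp_neg \<top> = 0\<close>: divergence simply means coverage
  probability 0, and no finiteness of the interference has to be established first. A product over
  the points is written as \<open>exp_neg\<close> of a sum of \<open>ln1p\<close> terms, the form to
  which the Laplace functional applies.

  The capacity gain depends on \<open>J\<close> alone because both schemes carry the same prefactor:
  thinning turns the exponent into \<open>(l / M) * pi * u * J u\<close>, interference reduction
  into \<open>l * pi * (u / M) * J (u / M)\<close>. The factor \<open>u / M\<close> and the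
  numerator \<open>- ln (1 - \<epsilon>)\<close> cancel in the ratio. Dividing the logarithm by
  \<open>J u\<close> gives the coefficient \<open>F 0 / J u\<close>; since
  \<open>A2_origin F f u\<close> is \<open>pi * J u\<close>, it becomes
  \<open>pi * F 0 / A2_origin F f u\<close>, which is the origin of the factor \<open>pi\<close>.

  Integrability is assumed only at the single value \<open>u\<close>; every \<open>u / M\<close>
  needed later inherits it by comparing kernels.\<close>

definition exp_neg :: "ennreal \<Rightarrow> real" where
  "exp_neg x = (if x = \<top> then 0 else exp (- enn2real x))"

lemma exp_neg_ennreal [simp]: "0 \<le> x \<Longrightarrow> exp_neg (ennreal x) = exp (- x)"
  by (simp add: exp_neg_def)

lemma exp_neg_0 [simp]: "exp_neg 0 = 1"
  by (simp add: exp_neg_def)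

lemma exp_neg_top [simp]: "exp_neg \<top> = 0"
  by (simp add: exp_neg_def)

lemma exp_neg_nonneg [simp]: "0 \<le> exp_neg x"
  by (simp add: exp_neg_def)

lemma exp_neg_le_1 [simp]: "exp_neg x \<le> 1"
  by (simp add: exp_neg_def)

lemma exp_neg_antimono: "x \<le> y \<Longrightarrow> exp_neg y \<le> exp_neg x"
  by (auto simp: exp_neg_def top_unique less_top intro!: enn2real_mono)

lemma exp_neg_add: "exp_neg (x + y) = exp_neg x * exp_neg y"
  by (cases x; cases y) (auto simp: exp_add[symmetric] simp flip: ennreal_plus)

lemma exp_neg_sum: "exp_neg (sum a I) = (\<Prod>i\<in>I. exp_neg (a i))"
  by (induction I rule: infinite_finite_induct) (simp_all add: exp_neg_add)

lemma measurable_exp_neg [measurable]: "exp_neg \<in> borel_measurable borel"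
  unfolding exp_neg_def[abs_def] by measurable

text \<open>Continuity at \<open>\<top>\<close> is what the value 0 there buys: limits of partial
  sums and of approximating functions pass through \<open>exp_neg\<close> even when they
  diverge.\<close>

lemma tendsto_exp_neg:
  assumes "(f \<longlongrightarrow> x) A"
  shows "((\<lambda>i. exp_neg (f i)) \<longlongrightarrow> exp_neg x) A"
proof (cases "x = \<top>")
  case False
  then have *: "eventually (\<lambda>i. f i < \<top>) A"
    using order_tendstoD(2)[OF assms, of \<top>] by (simp add: less_top)
  have "((\<lambda>i. exp (- enn2real (f i))) \<longlongrightarrow> exp (- enn2real x)) A"
    using False assms by (intro tendsto_intros tendsto_enn2real) (simp_all add: ennreal_enn2real_if)
  moreover have "eventually (\<lambda>i. exp (- enn2real (f i)) = exp_neg (f i)) A"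
    using * by eventually_elim (auto simp: exp_neg_def)
  ultimately show ?thesis
    using False by (subst tendsto_cong[symmetric, where f = "\<lambda>i. exp (- enn2real (f i))"])
      (auto simp: exp_neg_def)
next
  case True
  show ?thesis
  proof (rule tendstoI)
    fix e :: real assume "0 < e"
    \<comment> \<open>Beyond the threshold \<open>- ln (e/2)\<close> the exponential is at most
      \<open>e/2\<close>; the \<open>max 0\<close> covers large \<open>e\<close>, where this
      threshold would be negative.\<close>
    have "eventually (\<lambda>i. ennreal (max 0 (- ln (e/2))) < f i) A"
      using order_tendstoD(1)[OF assms] True by simp
    then show "eventually (\<lambda>i. dist (exp_neg (f i)) (exp_neg x) < e) A"
    proof eventually_elim
      case (elim i)
      have "exp_neg (f i) \<le> exp_neg (ennreal (max 0 (- ln (e/2))))"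
        using elim by (intro exp_neg_antimono) auto
      also have "\<dots> \<le> exp (ln (e/2))"
        by (simp add: max_def)
      also have "\<dots> < e"
        using \<open>0 < e\<close> by simp
      finally show ?case
        using True by simp
    qed
  qed
qed

text \<open>The Poisson weights sum to 1, so \<open>N\<close>, which could a priori be
  \<open>\<top>\<close> or fractional, is almost surely a natural number. The expectation is then an
  exponential series in \<open>m * exp (- t)\<close>.\<close>

lemma (in prob_space) nn_integral_exp_neg_Poisson:
  assumes N[measurable]: "N \<in> borel_measurable M" and "0 \<le> m" "0 \<le> t"
  assumes poisson: "\<And>k::nat. prob {\<omega> \<in> space M. N \<omega> = of_nat k} = m ^ k / fact k * exp (- m)"
  shows "(\<integral>\<^sup>+\<omega>. ennreal (exp_neg (ennreal t * N \<omega>)) \<partial>M) = ennreal (exp (- m * (1 - exp (- t))))"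
proof -
  let ?A = "\<lambda>k::nat. {\<omega> \<in> space M. N \<omega> = of_nat k}"
  have "(\<lambda>k. prob (?A k)) sums prob (\<Union>k. ?A k)"
    by (intro finite_measure_UNION) (auto simp: disjoint_family_on_def)
  moreover have "(\<lambda>k. prob (?A k)) sums (exp m * exp (- m))"
    unfolding poisson using sums_mult2[OF exp_converges[of m], of "exp (-m)"]
    by (simp add: divide_inverse mult.commute)
  ultimately have "prob (\<Union>k. ?A k) = 1"
    by (simp add: sums_iff exp_minus)
  then have "AE \<omega> in M. \<omega> \<in> (\<Union>k. ?A k)"
    by (intro AE_prob_1)
  then have ae: "AE \<omega> in M. ennreal (exp_neg (ennreal t * N \<omega>)) =
      (\<Sum>k. ennreal (exp (- t * real k)) * indicator (?A k) \<omega>)"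
  proof eventually_elim
    case (elim \<omega>)
    then obtain k :: nat where k: "\<omega> \<in> space M" "N \<omega> = of_nat k" by auto
    have "(\<Sum>k. ennreal (exp (- t * real k)) * indicator (?A k) \<omega>) =
        (\<Sum>j\<in>{k}. ennreal (exp (- t * real j)) * indicator (?A j) \<omega>)"
      using k by (intro suminf_finite) auto
    also have "\<dots> = ennreal (exp_neg (ennreal t * N \<omega>))"
      using k \<open>0 \<le> t\<close> by (simp add: ennreal_of_nat_eq_real_of_nat flip: ennreal_mult)
    finally show ?case ..
  qed
  have "(\<integral>\<^sup>+\<omega>. ennreal (exp_neg (ennreal t * N \<omega>)) \<partial>M) =
      (\<Sum>k. \<integral>\<^sup>+\<omega>. ennreal (exp (- t * real k)) * indicator (?A k) \<omega> \<partial>M)"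
    using ae by (subst nn_integral_suminf[symmetric]) (auto intro: nn_integral_cong_AE)
  also have "\<dots> = (\<Sum>k. ennreal (exp (- t * real k) * prob (?A k)))"
    by (subst nn_integral_cmult_indicator) (auto simp: emeasure_eq_measure ennreal_mult)
  also have "\<dots> = ennreal (exp (m * exp (- t)) * exp (- m))"
  proof (rule suminf_ennreal_eq)
    have "(\<lambda>k. (m * exp (- t)) ^ k /\<^sub>R fact k * exp (- m)) sums (exp (m * exp (- t)) * exp (- m))"
      by (intro sums_mult2 exp_converges)
    also have "(\<lambda>k. (m * exp (- t)) ^ k /\<^sub>R fact k * exp (- m)) = (\<lambda>k. exp (- t * real k) * prob (?A k))"
      by (simp add: poisson fun_eq_iff power_mult_distrib divide_inverse mult_ac
          flip: exp_of_nat_mult)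
    finally show "(\<lambda>k. exp (- t * real k) * prob (?A k)) sums (exp (m * exp (- t)) * exp (- m))" .
  qed simp
  also have "exp (m * exp (- t)) * exp (- m) = exp (- m * (1 - exp (- t)))"
    by (simp add: exp_add[symmetric] algebra_simps)
  finally show ?thesis .
qed

section \<open>Sums over the points and their Laplace transform\<close>

definition point_sum :: "('w \<Rightarrow> enat) \<Rightarrow> (nat \<Rightarrow> 'w \<Rightarrow> 'a) \<Rightarrow> ('a \<Rightarrow> ennreal) \<Rightarrow> 'w \<Rightarrow> ennreal" where
  "point_sum K X h \<omega> = (\<Sum>n. if enat n < K \<omega> then h (X n \<omega>) else 0)"

text \<open>As an integral against counting measure, a point sum inherits linearity and monotone
  convergence from \<open>nn_integral\<close>.\<close>

lemma point_sum_nn_integral: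
  "point_sum K X h \<omega> = (\<integral>\<^sup>+n. h (X n \<omega>) * indicator {n. enat n < K \<omega>} n \<partial>count_space UNIV)"
  unfolding point_sum_def by (subst nn_integral_count_space_nat) (auto intro!: suminf_cong)

lemma num_points_point_sum: "num_points K X B = point_sum K X (indicator B)"
  by (simp add: fun_eq_iff num_points_def point_sum_def)

lemma point_sum_sum:
  "point_sum K X (\<lambda>x. \<Sum>i\<in>I. b i * h i x) \<omega> = (\<Sum>i\<in>I. b i * point_sum K X (h i) \<omega>)"
  unfolding point_sum_nn_integral
  by (simp add: sum_distrib_right nn_integral_sum nn_integral_cmult mult.assoc)

lemma tendsto_point_sum:
  assumes "incseq h"
  shows "(\<lambda>i. point_sum K X (h i) \<omega>) \<longlonglongrightarrow> point_sum K X (\<lambda>x. SUP i. h i x) \<omega>"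
proof -
  have "incseq (\<lambda>i. point_sum K X (h i) \<omega>)"
    unfolding point_sum_nn_integral using assms
    by (auto simp: incseq_def le_fun_def intro!: nn_integral_mono mult_right_mono)
  moreover have "point_sum K X (\<lambda>x. SUP i. h i x) \<omega> = (SUP i. point_sum K X (h i) \<omega>)"
    unfolding point_sum_nn_integral SUP_mult_right_ennreal using assms
    by (intro nn_integral_monotone_convergence_SUP)
      (auto simp: incseq_def le_fun_def intro!: mult_right_mono)
  ultimately show ?thesis
    using LIMSEQ_SUP by metis
qed

context poisson_point_process
begin

lemma measurable_point_sum [measurable]:
  assumes [measurable]: "h \<in> borel_measurable borel"
  shows "point_sum K X h \<in> borel_measurable \<Omega>"
proof -
  note [measurable] = measurable_K measurable_X
  show ?thesis unfolding point_sum_def[abs_def] by measurable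
qed

text \<open>The level sets of the nonzero values of \<open>h\<close> are disjoint, so their point
  counts are independent, and each has finite intensity, so the counts are Poisson. The Laplace
  transform factors accordingly.\<close>

lemma laplace_functional_simple:
  assumes h: "simple_function borel h" and fin: "\<And>x. h x < \<top>"
    and supp: "emeasure \<Lambda> {x. h x \<noteq> 0} < \<infinity>"
  shows "(\<integral>\<^sup>+\<omega>. ennreal (exp_neg (point_sum K X h \<omega>)) \<partial>\<Omega>) =
    ennreal (exp_neg (\<integral>\<^sup>+x. ennreal (1 - exp_neg (h x)) \<partial>\<Lambda>))"
proof -
  note [measurable_cong] = sets_intensity
  have [measurable]: "h \<in> borel_measurable borel"
    using h by (rule borel_measurable_simple_function)
  define S where "S = range h - {0}"
  have "finite S"
    using simple_functionD(1)[OF h] by (simp add: S_def)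
  then obtain b where b: "bij_betw b {0..<card S} S"
    using ex_bij_betw_nat_finite by blast
  define I where "I = {0..<card S}"
  have bI: "b i \<noteq> 0" "b i < \<top>" if "i \<in> I" for i
    using bij_betwE[OF b] that fin by (auto simp: I_def S_def dest!: bspec)
  have inj: "inj_on b I" and im: "b ` I = S"
    using b by (auto simp: bij_betw_def I_def)
  define B where "B i = {x. h x = b i}" for i
  have [measurable]: "B i \<in> sets borel" for i
    unfolding B_def by measurable
  have B_fin: "emeasure \<Lambda> (B i) < \<infinity>" if "i \<in> I" for i
  proof (rule le_less_trans[OF emeasure_mono supp])
    show "B i \<subseteq> {x. h x \<noteq> 0}" using bI[OF that] by (auto simp: B_def)
    have "{x. h x \<noteq> 0} \<in> sets borel" by measurable
    then show "{x. h x \<noteq> 0} \<in> sets \<Lambda>" by (simp add: sets_intensity)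
  qed
  have disj: "disjoint_family_on B I"
    using inj by (auto simp: disjoint_family_on_def B_def inj_on_def)
  \<comment> \<open>The free \<open>\<phi>\<close> allows two uses: \<open>1 - exp_neg\<close> for
    the intensity integral and the identity for the point sum. The condition
    \<open>\<phi> 0 = 0\<close> discards the level set of 0, whose measure may be infinite.\<close>
  have repr: "\<phi> (h x) = (\<Sum>i\<in>I. \<phi> (b i) * indicator (B i) x)" if "\<phi> 0 = 0"
    for \<phi> :: "ennreal \<Rightarrow> ennreal" and x
  proof -
    have "(\<Sum>i\<in>I. \<phi> (b i) * indicator (B i) x) = (\<Sum>y\<in>S. if h x = y then \<phi> y else 0)"
      unfolding im[symmetric] sum.reindex[OF inj] by (auto intro!: sum.cong simp: B_def)
    also have "\<dots> = \<phi> (h x)"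
      using \<open>finite S\<close> that by (auto simp: S_def)
    finally show ?thesis ..
  qed
  define m where "m i = measure \<Lambda> (B i)" for i
  have "(\<integral>\<^sup>+x. ennreal (1 - exp_neg (h x)) \<partial>\<Lambda>) =
      (\<integral>\<^sup>+x. (\<Sum>i\<in>I. ennreal (1 - exp_neg (b i)) * indicator (B i) x) \<partial>\<Lambda>)"
    by (subst repr[of "\<lambda>y. ennreal (1 - exp_neg y)"]) simp_all
  also have "\<dots> = (\<Sum>i\<in>I. ennreal (1 - exp_neg (b i)) * emeasure \<Lambda> (B i))"
    by (subst nn_integral_sum) (auto simp: nn_integral_cmult_indicator)
  also have "\<dots> = (\<Sum>i\<in>I. ennreal (m i * (1 - exp_neg (b i))))"
    using B_fin by (intro sum.cong refl)
      (auto simp: m_def emeasure_eq_ennreal_measure less_top ennreal_mult mult.commute)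
  finally have rhs: "exp_neg (\<integral>\<^sup>+x. ennreal (1 - exp_neg (h x)) \<partial>\<Lambda>) =
      (\<Prod>i\<in>I. exp (- m i * (1 - exp_neg (b i))))"
    by (simp add: exp_neg_sum m_def del: sum_ennreal)
  have "point_sum K X h \<omega> = (\<Sum>i\<in>I. b i * num_points K X (B i) \<omega>)" for \<omega>
    by (subst repr[of "\<lambda>y. y", THEN ext]) (simp_all add: point_sum_sum num_points_point_sum)
  then have "(\<integral>\<^sup>+\<omega>. ennreal (exp_neg (point_sum K X h \<omega>)) \<partial>\<Omega>) =
      (\<integral>\<^sup>+\<omega>. (\<Prod>i\<in>I. ennreal (exp_neg (b i * num_points K X (B i) \<omega>))) \<partial>\<Omega>)"
    by (simp add: exp_neg_sum prod_ennreal)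
  also have "\<dots> = (\<Prod>i\<in>I. \<integral>\<^sup>+\<omega>. ennreal (exp_neg (b i * num_points K X (B i) \<omega>)) \<partial>\<Omega>)"
    using disj indep_vars_compose2[OF indep_count[of I B],
        of "\<lambda>i y. ennreal (exp_neg (b i * y))" "\<lambda>_. borel"]
    by (intro indep_vars_nn_integral) (auto simp: I_def)
  also have "\<dots> = (\<Prod>i\<in>I. ennreal (exp (- m i * (1 - exp_neg (b i)))))"
  proof (rule prod.cong)
    fix i assume i: "i \<in> I"
    obtain t where t: "0 \<le> t" "b i = ennreal t"
      using bI[OF i] by (cases "b i") auto
    show "(\<integral>\<^sup>+\<omega>. ennreal (exp_neg (b i * num_points K X (B i) \<omega>)) \<partial>\<Omega>) =
        ennreal (exp (- m i * (1 - exp_neg (b i))))"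
      using nn_integral_exp_neg_Poisson[of "num_points K X (B i)" "m i" t] t
        poisson_count[OF _ B_fin[OF i]] by (simp add: m_def num_points_point_sum)
  qed simp
  finally show ?thesis
    unfolding rhs by (simp add: prod_ennreal)
qed

text \<open>Simple approximants may have support of infinite measure, hence the truncation to
  growing balls. The left side converges by domination by 1, the right side by monotone convergence,
  since \<open>1 - exp_neg\<close> is increasing.\<close>

theorem laplace_functional:
  assumes h[measurable]: "h \<in> borel_measurable borel"
    and fin: "\<And>i::nat. emeasure \<Lambda> (ball 0 (real i)) < \<infinity>"
  shows "(\<integral>\<^sup>+\<omega>. ennreal (exp_neg (point_sum K X h \<omega>)) \<partial>\<Omega>) =
    ennreal (exp_neg (\<integral>\<^sup>+x. ennreal (1 - exp_neg (h x)) \<partial>\<Lambda>))"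
proof -
  note [measurable_cong] = sets_intensity
  obtain u where u: "\<And>i. simple_function borel (u i)" "incseq u" "\<And>i x. u i x < \<top>"
      "\<And>x. (SUP i. u i x) = h x"
    using borel_measurable_implies_simple_function_sequence'[OF h] by metis
  define v where "v i x = u i x * indicator (ball 0 (real i)) x" for i x
  have v_simple: "simple_function borel (v i)" for i
    unfolding v_def using u(1) by (intro simple_function_mult simple_function_indicator) auto
  have [measurable]: "v i \<in> borel_measurable borel" for i
    using v_simple by (rule borel_measurable_simple_function)
  have v_inc: "incseq v"
    unfolding incseq_def le_fun_def v_def
    using u(2) by (auto intro!: mult_mono simp: incseq_def le_fun_def indicator_def)
  have v_sup: "(SUP i. v i x) = h x" for x
  proof (rule antisym)
    show "(SUP i. v i x) \<le> h x"
      unfolding u(4)[symmetric] v_def by (intro SUP_mono) (auto simp: indicator_def)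
    obtain j :: nat where j: "norm x < j"
      using reals_Archimedean2 by blast
    \<comment> \<open>Raising the index to at least \<open>j\<close> puts \<open>x\<close> inside
      the ball, where truncation has no effect, and only increases \<open>u\<close>.\<close>
    have "u i x \<le> v (max i j) x" for i
      using j u(2) by (auto simp: v_def incseq_def le_fun_def)
    then show "h x \<le> (SUP i. v i x)"
      unfolding u(4)[symmetric] by (intro SUP_least) (meson SUP_upper2 UNIV_I)
  qed
  have eq: "(\<integral>\<^sup>+\<omega>. ennreal (exp_neg (point_sum K X (v i) \<omega>)) \<partial>\<Omega>) =
      ennreal (exp_neg (\<integral>\<^sup>+x. ennreal (1 - exp_neg (v i x)) \<partial>\<Lambda>))" for i
  proof (rule laplace_functional_simple[OF v_simple])
    show "v i x < \<top>" for x
      using u(3) by (simp add: v_def indicator_def)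
    show "emeasure \<Lambda> {x. v i x \<noteq> 0} < \<infinity>"
      by (rule le_less_trans[OF emeasure_mono fin[of i]])
        (auto simp: v_def sets_intensity indicator_def split: if_splits)
  qed
  have "(\<lambda>i. \<integral>\<^sup>+\<omega>. ennreal (exp_neg (point_sum K X (v i) \<omega>)) \<partial>\<Omega>) \<longlonglongrightarrow>
      (\<integral>\<^sup>+\<omega>. ennreal (exp_neg (point_sum K X h \<omega>)) \<partial>\<Omega>)"
    using tendsto_point_sum[OF v_inc, of K X, unfolded v_sup]
    by (intro nn_integral_dominated_convergence[where w = "\<lambda>_. 1"])
      (auto intro!: tendsto_ennrealI tendsto_exp_neg simp: emeasure_space_1)
  moreover have "(\<lambda>i. \<integral>\<^sup>+x. ennreal (1 - exp_neg (v i x)) \<partial>\<Lambda>) \<longlonglongrightarrow>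
      (\<integral>\<^sup>+x. ennreal (1 - exp_neg (h x)) \<partial>\<Lambda>)"
  proof (rule nn_integral_LIMSEQ)
    show "incseq (\<lambda>i x. ennreal (1 - exp_neg (v i x)))"
      using v_inc by (auto simp: incseq_def le_fun_def intro!: ennreal_leI exp_neg_antimono)
    show "(\<lambda>i. ennreal (1 - exp_neg (v i x))) \<longlonglongrightarrow> ennreal (1 - exp_neg (h x))" for x
    proof (intro tendsto_ennrealI tendsto_diff tendsto_const tendsto_exp_neg)
      have "incseq (\<lambda>i. v i x)" using v_inc by (auto simp: incseq_def le_fun_def)
      from LIMSEQ_SUP[OF this] show "(\<lambda>i. v i x) \<longlonglongrightarrow> h x" by (simp add: v_sup)
    qed
  qed measurable
  from tendsto_ennrealI[OF tendsto_exp_neg[OF this]]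
  have "(\<lambda>i. ennreal (exp_neg (\<integral>\<^sup>+x. ennreal (1 - exp_neg (v i x)) \<partial>\<Lambda>))) \<longlonglongrightarrow>
      ennreal (exp_neg (\<integral>\<^sup>+x. ennreal (1 - exp_neg (h x)) \<partial>\<Lambda>))" .
  ultimately show ?thesis
    unfolding eq by (rule LIMSEQ_unique)
qed

end


subsection \<open>Rayleigh fading\<close>

text \<open>This replaces conditioning on \<open>Y\<close>: independence makes the joint law a
  product measure, and Tonelli integrates out \<open>X\<close> with \<open>Y\<close> frozen.\<close>

lemma (in prob_space) indep_set_emeasure:
  assumes X[measurable]: "X \<in> M \<rightarrow>\<^sub>M S" and Y[measurable]: "Y \<in> M \<rightarrow>\<^sub>M T"
    and indep: "indep_set (sets (vimage_algebra (space M) X S)) (sets (vimage_algebra (space M) Y T))"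
    and A[measurable]: "A \<in> sets (S \<Otimes>\<^sub>M T)"
  shows "emeasure M {\<omega> \<in> space M. (X \<omega>, Y \<omega>) \<in> A} =
    (\<integral>\<^sup>+\<omega>'. emeasure M {\<omega> \<in> space M. (X \<omega>, Y \<omega>') \<in> A} \<partial>M)"
proof -
  interpret X: prob_space "distr M S X" by (rule prob_space_distr) simp
  interpret Y: prob_space "distr M T Y" by (rule prob_space_distr) simp
  interpret XY: pair_sigma_finite "distr M S X" "distr M T Y" ..
  have eq: "distr M S X \<Otimes>\<^sub>M distr M T Y = distr M (S \<Otimes>\<^sub>M T) (\<lambda>\<omega>. (X \<omega>, Y \<omega>))"
  proof (rule pair_measure_eqI)
    fix B C assume "B \<in> sets (distr M S X)" "C \<in> sets (distr M T Y)"
    then have [measurable]: "B \<in> sets S" "C \<in> sets T" by auto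
    have "prob ((X -` B \<inter> space M) \<inter> (Y -` C \<inter> space M)) = prob (X -` B \<inter> space M) * prob (Y -` C \<inter> space M)"
      by (intro indep_setD[OF indep] in_vimage_algebra) auto
    moreover have "(\<lambda>\<omega>. (X \<omega>, Y \<omega>)) -` (B \<times> C) \<inter> space M = (X -` B \<inter> space M) \<inter> (Y -` C \<inter> space M)"
      by auto
    ultimately show "emeasure (distr M S X) B * emeasure (distr M T Y) C =
        emeasure (distr M (S \<Otimes>\<^sub>M T) (\<lambda>\<omega>. (X \<omega>, Y \<omega>))) (B \<times> C)"
      by (simp add: emeasure_distr emeasure_eq_measure ennreal_mult)
  qed (simp_all add: X.sigma_finite_measure_axioms Y.sigma_finite_measure_axioms cong: sets_pair_measure_cong)
  have "emeasure M {\<omega> \<in> space M. (X \<omega>, Y \<omega>) \<in> A} = emeasure (distr M (S \<Otimes>\<^sub>M T) (\<lambda>\<omega>. (X \<omega>, Y \<omega>))) A"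
    by (subst emeasure_distr) (auto intro!: arg_cong[where f = "emeasure M"])
  also have "\<dots> = (\<integral>\<^sup>+y. emeasure (distr M S X) ((\<lambda>x. (x, y)) -` A) \<partial>distr M T Y)"
    unfolding eq[symmetric] by (subst XY.emeasure_pair_measure_alt2) auto
  also have "\<dots> = (\<integral>\<^sup>+\<omega>'. emeasure (distr M S X) ((\<lambda>x. (x, Y \<omega>')) -` A) \<partial>M)"
    using XY.measurable_emeasure_Pair2[of A] by (intro nn_integral_distr) simp_all
  also have "\<dots> = (\<integral>\<^sup>+\<omega>'. emeasure M {\<omega> \<in> space M. (X \<omega>, Y \<omega>') \<in> A} \<partial>M)"
    by (intro nn_integral_cong, subst emeasure_distr)
      (auto intro!: arg_cong[where f = "emeasure M"] sets_Pair2[OF A])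
  finally show ?thesis .
qed

lemma (in prob_space) exponential_distributed_pos:
  assumes "distributed M lborel X (exponential_density 1)"
  shows "AE \<omega> in M. 0 < X \<omega>"
  using exponential_distributedD_gt[OF assms, of 0] AE_prob_1[of "{\<omega> \<in> space M. 0 < X \<omega>}"] by simp

lemma (in prob_space) exponential_distributed_ge:
  assumes X: "distributed M lborel X (exponential_density 1)" and "0 \<le> s"
  shows "emeasure M {\<omega> \<in> space M. s \<le> X \<omega>} = ennreal (exp (- s))"
proof -
  have [measurable]: "X \<in> borel_measurable M"
    using distributed_measurable[OF X] by simp
  have "AE \<omega> in M. X \<omega> \<noteq> s"
    using AE_lborel_singleton[of s] by (subst distributed_AE2[OF X]) auto
  then have "emeasure M {\<omega> \<in> space M. s \<le> X \<omega>} = emeasure M {\<omega> \<in> space M. s < X \<omega>}"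
    by (intro emeasure_eq_AE) auto
  then show ?thesis
    using exponential_distributedD_gt[OF X \<open>0 \<le> s\<close>] by (simp add: emeasure_eq_measure)
qed

text \<open>Tilting the rate 1 density by \<open>exp (- (a * x))\<close> gives the density of rate
  \<open>1 + a\<close> up to the factor \<open>1 / (1 + a)\<close>, and that density has mass
  1.\<close>

lemma (in prob_space) exponential_distributed_laplace:
  assumes X: "distributed M lborel X (exponential_density 1)" and "0 \<le> a"
  shows "(\<integral>\<^sup>+\<omega>. ennreal (exp (- (a * X \<omega>))) \<partial>M) = ennreal (1 / (1 + a))"
proof -
  interpret D: prob_space "density lborel (exponential_density (1 + a))"
    using \<open>0 \<le> a\<close> by (intro prob_space_exponential_density) simp
  have "(\<integral>\<^sup>+\<omega>. ennreal (exp (- (a * X \<omega>))) \<partial>M) =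
      (\<integral>\<^sup>+x. ennreal (exponential_density 1 x) * ennreal (exp (- (a * x))) \<partial>lborel)"
    by (rule distributed_nn_integral[OF X, symmetric]) simp
  also have "\<dots> = (\<integral>\<^sup>+x. ennreal (1 / (1 + a)) * ennreal (exponential_density (1 + a) x) \<partial>lborel)"
  proof (rule nn_integral_cong)
    fix x
    have "exp (- x) * exp (- (a * x)) = exp (- x * (1 + a))"
      by (simp add: exp_add[symmetric] algebra_simps)
    then have "exponential_density 1 x * exp (- (a * x)) = 1 / (1 + a) * exponential_density (1 + a) x"
      using \<open>0 \<le> a\<close> by (simp add: exponential_density_def)
    then show "ennreal (exponential_density 1 x) * ennreal (exp (- (a * x))) =
        ennreal (1 / (1 + a)) * ennreal (exponential_density (1 + a) x)"
      using \<open>0 \<le> a\<close> by (simp add: exponential_density_nonneg flip: ennreal_mult)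
  qed
  also have "\<dots> = ennreal (1 / (1 + a)) * emeasure (density lborel (exponential_density (1 + a))) UNIV"
    by (simp add: nn_integral_cmult emeasure_density)
  finally show ?thesis
    using D.emeasure_space_1 by simp
qed

text \<open>Chosen so that \<open>exp_neg (ln1p a)\<close> is the coverage factor
  \<open>1 / (1 + a)\<close> of one interferer of weight \<open>a\<close>; the value at
  \<open>\<top>\<close> gives the factor 0.\<close>

definition ln1p :: "ennreal \<Rightarrow> ennreal" where
  "ln1p a = (if a = \<top> then \<top> else ennreal (ln (1 + enn2real a)))"

lemma measurable_ln1p [measurable]: "ln1p \<in> borel_measurable borel"
  unfolding ln1p_def[abs_def] by measurable

lemma ln1p_0 [simp]: "ln1p 0 = 0"
  by (simp add: ln1p_def)

lemma ln1p_top [simp]: "ln1p \<top> = \<top>"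
  by (simp add: ln1p_def)

lemma exp_neg_ln1p: "0 \<le> a \<Longrightarrow> exp_neg (ln1p (ennreal a)) = 1 / (1 + a)"
  by (simp add: ln1p_def exp_minus divide_inverse)

context rayleigh_network
begin

lemma measurable_fading [measurable]: "g n \<in> borel_measurable \<Omega>" "g\<^sub>0 \<in> borel_measurable \<Omega>"
  using distributed_measurable[OF exponential_g] distributed_measurable[OF exponential_g0] by simp_all

lemma AE_fading_pos: "AE \<omega> in \<Omega>. (\<forall>n. 0 < g n \<omega>) \<and> 0 < g\<^sub>0 \<omega>"
  using exponential_distributed_pos[OF exponential_g] exponential_distributed_pos[OF exponential_g0]
  by (simp add: AE_all_countable)

text \<open>With the weighted sum \<open>S\<close> frozen, the exponential tail of
  \<open>g\<^sub>0\<close> gives \<open>exp (- S)\<close>. Independence splits its expectation into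
  Laplace transforms of the single coefficients.\<close>

lemma fading_finite:
  assumes a: "\<And>i. 0 \<le> a i"
  shows "emeasure \<Omega> {\<omega> \<in> space \<Omega>. (\<Sum>i<N. a i * g i \<omega>) \<le> g\<^sub>0 \<omega>} = ennreal (\<Prod>i<N. 1 / (1 + a i))"
proof -
  define Y where "Y j \<omega> = (case j of None \<Rightarrow> g\<^sub>0 \<omega> | Some i \<Rightarrow> a i * g i \<omega>)" for j \<omega>
  define S where "S \<omega> = (\<Sum>i<N. a i * g i \<omega>)" for \<omega>
  have S[measurable]: "S \<in> borel_measurable \<Omega>"
    unfolding S_def[abs_def] by measurable
  have "indep_vars (\<lambda>_. borel) (\<lambda>j \<omega>. (case j of None \<Rightarrow> (\<lambda>y. y) | Some i \<Rightarrow> (\<lambda>y. a i * y))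
      (case_option g\<^sub>0 g j \<omega>)) (UNIV :: nat option set)"
    by (rule indep_vars_compose2[OF indep_fading]) (auto split: option.split)
  also have "(\<lambda>j \<omega>. (case j of None \<Rightarrow> (\<lambda>y. y) | Some i \<Rightarrow> (\<lambda>y. a i * y)) (case_option g\<^sub>0 g j \<omega>)) = Y"
    by (auto simp: Y_def fun_eq_iff split: option.split)
  finally have Y: "indep_vars (\<lambda>_. borel) Y UNIV" .
  have "indep_var borel (Y None) borel (\<lambda>\<omega>. \<Sum>j\<in>Some ` {..<N}. Y j \<omega>)"
    by (rule indep_vars_sum[OF _ _ indep_vars_subset[OF Y]]) auto
  moreover have "Y None = g\<^sub>0" "(\<lambda>\<omega>. \<Sum>j\<in>Some ` {..<N}. Y j \<omega>) = S"
    by (simp_all add: Y_def S_def fun_eq_iff sum.reindex)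
  ultimately have indep: "indep_var borel g\<^sub>0 borel S" by simp
  have "{p \<in> space (borel \<Otimes>\<^sub>M borel). snd p \<le> (fst p :: real)} \<in> sets (borel \<Otimes>\<^sub>M borel)"
    by measurable
  then have A: "{p :: real \<times> real. snd p \<le> fst p} \<in> sets (borel \<Otimes>\<^sub>M borel)"
    by (simp add: space_pair_measure)
  have S_nonneg: "AE \<omega> in \<Omega>. 0 \<le> S \<omega>"
    using AE_fading_pos by eventually_elim (auto simp: S_def a less_imp_le intro!: sum_nonneg)
  have "emeasure \<Omega> {\<omega> \<in> space \<Omega>. S \<omega> \<le> g\<^sub>0 \<omega>} =
      (\<integral>\<^sup>+\<omega>'. emeasure \<Omega> {\<omega> \<in> space \<Omega>. S \<omega>' \<le> g\<^sub>0 \<omega>} \<partial>\<Omega>)"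
    using indep_set_emeasure[OF _ _ _ A, of g\<^sub>0 S] indep
    by (simp add: indep_var_eq sets_vimage_algebra)
  also have "\<dots> = (\<integral>\<^sup>+\<omega>. ennreal (exp (- S \<omega>)) \<partial>\<Omega>)"
    using S_nonneg by (intro nn_integral_cong_AE, eventually_elim)
      (rule exponential_distributed_ge[OF exponential_g0])
  also have "\<dots> = (\<integral>\<^sup>+\<omega>. (\<Prod>j\<in>Some ` {..<N}. ennreal (exp (- Y j \<omega>))) \<partial>\<Omega>)"
    by (simp add: S_def Y_def prod.reindex prod_ennreal exp_sum flip: sum_negf)
  also have "\<dots> = (\<Prod>j\<in>Some ` {..<N}. \<integral>\<^sup>+\<omega>. ennreal (exp (- Y j \<omega>)) \<partial>\<Omega>)"
    using indep_vars_compose2[OF indep_vars_subset[OF Y, of "Some ` {..<N}"],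
        of "\<lambda>_ y. ennreal (exp (- y))" "\<lambda>_. borel"]
    by (intro indep_vars_nn_integral) auto
  also have "\<dots> = ennreal (\<Prod>i<N. 1 / (1 + a i))"
    using a by (simp add: Y_def prod.reindex exponential_distributed_laplace[OF exponential_g]
        prod_ennreal)
  finally show ?thesis
    by (simp add: S_def)
qed

text \<open>One infinite weight makes the interference infinite almost surely, as fading is
  positive, and both sides are 0. Otherwise the finite formula passes to the limit along the
  decreasing events \<open>E N\<close>.\<close>

lemma fading_coverage:
  "emeasure \<Omega> {\<omega> \<in> space \<Omega>. (\<Sum>n. a n * ennreal (g n \<omega>)) \<le> ennreal (g\<^sub>0 \<omega>)} =
    ennreal (exp_neg (\<Sum>n. ln1p (a n)))"
proof (cases "\<exists>j. a j = \<top>")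
  case True
  then obtain j where j: "a j = \<top>" ..
  have "ln1p (a j) \<le> (\<Sum>n. ln1p (a n))"
    using sum_le_suminf[of "\<lambda>n. ln1p (a n)" "{j}"] by simp
  then have rhs: "(\<Sum>n. ln1p (a n)) = \<top>"
    using j by (simp add: top_unique)
  have "AE \<omega> in \<Omega>. \<not> (\<Sum>n. a n * ennreal (g n \<omega>)) \<le> ennreal (g\<^sub>0 \<omega>)"
    using AE_fading_pos
  proof eventually_elim
    case (elim \<omega>)
    have "a j * ennreal (g j \<omega>) \<le> (\<Sum>n. a n * ennreal (g n \<omega>))"
      using sum_le_suminf[of "\<lambda>n. a n * ennreal (g n \<omega>)" "{j}"] by simp
    moreover have "a j * ennreal (g j \<omega>) = \<top>"
      using elim j by (simp add: ennreal_top_mult ennreal_eq_0_iff not_le)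
    ultimately show ?case
      by (simp add: top_unique)
  qed
  then have "emeasure \<Omega> {\<omega> \<in> space \<Omega>. (\<Sum>n. a n * ennreal (g n \<omega>)) \<le> ennreal (g\<^sub>0 \<omega>)} = 0"
    by (subst (asm) AE_iff_measurable[OF _ refl]) auto
  then show ?thesis
    by (simp add: rhs)
next
  case False
  define \<alpha> where "\<alpha> n = enn2real (a n)" for n
  have a: "a n = ennreal (\<alpha> n)" and \<alpha>: "0 \<le> \<alpha> n" for n
    using False by (auto simp: \<alpha>_def ennreal_enn2real_if)
  define E where "E N = {\<omega> \<in> space \<Omega>. (\<Sum>n<N. a n * ennreal (g n \<omega>)) \<le> ennreal (g\<^sub>0 \<omega>)}" for N
  have E_meas: "E N \<in> sets \<Omega>" for N
    unfolding E_def by measurable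
  have "decseq E"
  proof (rule decseq_SucI)
    fix N
    show "E (Suc N) \<subseteq> E N"
      unfolding E_def by (auto intro: order_trans[rotated])
  qed
  have E_eq: "emeasure \<Omega> (E N) = ennreal (exp_neg (\<Sum>n<N. ln1p (a n)))" for N
  proof -
    have "emeasure \<Omega> (E N) = emeasure \<Omega> {\<omega> \<in> space \<Omega>. (\<Sum>i<N. \<alpha> i * g i \<omega>) \<le> g\<^sub>0 \<omega>}"
    proof (rule emeasure_eq_AE)
      show "AE \<omega> in \<Omega>. \<omega> \<in> E N \<longleftrightarrow> \<omega> \<in> {\<omega> \<in> space \<Omega>. (\<Sum>i<N. \<alpha> i * g i \<omega>) \<le> g\<^sub>0 \<omega>}"
        using AE_fading_pos
      proof eventually_elim
        case (elim \<omega>)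
        then have "(\<Sum>n<N. a n * ennreal (g n \<omega>)) = ennreal (\<Sum>n<N. \<alpha> n * g n \<omega>)"
          using \<alpha> by (subst sum_ennreal[symmetric]) (auto simp: a ennreal_mult less_imp_le)
        then show ?case
          using elim by (simp add: E_def)
      qed
    qed (auto intro: E_meas)
    also have "\<dots> = ennreal (\<Prod>i<N. 1 / (1 + \<alpha> i))"
      using \<alpha> by (rule fading_finite)
    finally show ?thesis
      using \<alpha> by (simp add: exp_neg_sum a exp_neg_ln1p)
  qed
  have "(\<lambda>N. emeasure \<Omega> (E N)) \<longlonglongrightarrow> emeasure \<Omega> (\<Inter>N. E N)"
    using E_meas \<open>decseq E\<close> by (intro Lim_emeasure_decseq) auto
  moreover have "(\<lambda>N. ennreal (exp_neg (\<Sum>n<N. ln1p (a n)))) \<longlonglongrightarrow> ennreal (exp_neg (\<Sum>n. ln1p (a n)))"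
    by (intro tendsto_ennrealI tendsto_exp_neg summable_LIMSEQ) simp
  \<comment> \<open>A sum in \<open>ennreal\<close> is the supremum of its partial sums, so the
    closed condition \<open>\<le>\<close> holds for the sum exactly when it holds for every partial
    sum.\<close>
  moreover have "(\<Inter>N. E N) = {\<omega> \<in> space \<Omega>. (\<Sum>n. a n * ennreal (g n \<omega>)) \<le> ennreal (g\<^sub>0 \<omega>)}"
    by (auto simp: E_def suminf_eq_SUP SUP_le_iff)
  ultimately show ?thesis
    unfolding E_eq by (metis LIMSEQ_unique)
qed

text \<open>With \<open>(K, X)\<close> frozen the weights are constants and
  \<open>fading_coverage\<close> applies; indices from \<open>K\<close> on get weight 0 and hence
  contribute the factor 1. Averaging over the points is then a Laplace functional.\<close>

theorem coverage_probability:
  assumes a[measurable]: "a \<in> borel_measurable borel"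
    and fin: "\<And>i::nat. emeasure \<Lambda> (ball 0 (real i)) < \<infinity>"
  shows "emeasure \<Omega> {\<omega> \<in> space \<Omega>.
      (\<Sum>n. if enat n < K \<omega> then a (X n \<omega>) * ennreal (g n \<omega>) else 0) \<le> ennreal (g\<^sub>0 \<omega>)} =
    ennreal (exp_neg (\<integral>\<^sup>+x. ennreal (1 - exp_neg (ln1p (a x))) \<partial>\<Lambda>))"
proof -
  note [measurable] = measurable_K measurable_X
  let ?G = "borel \<Otimes>\<^sub>M (\<Pi>\<^sub>M n\<in>UNIV. borel) :: (real \<times> (nat \<Rightarrow> real)) measure"
  let ?P = "count_space UNIV \<Otimes>\<^sub>M (\<Pi>\<^sub>M n\<in>UNIV. borel) :: (enat \<times> (nat \<Rightarrow> 'a)) measure"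
  define G where "G \<omega> = (g\<^sub>0 \<omega>, \<lambda>n. g n \<omega>)" for \<omega>
  define Q where "Q \<omega> = (K \<omega>, \<lambda>n. X n \<omega>)" for \<omega>
  define A where "A = {p \<in> space (?G \<Otimes>\<^sub>M ?P).
    (\<Sum>n. if enat n < fst (snd p) then a (snd (snd p) n) * ennreal (snd (fst p) n) else 0)
      \<le> ennreal (fst (fst p))}"
  have [measurable]: "G \<in> \<Omega> \<rightarrow>\<^sub>M ?G" "Q \<in> \<Omega> \<rightarrow>\<^sub>M ?P"
    unfolding G_def[abs_def] Q_def[abs_def]
    by (auto intro!: measurable_Pair measurable_PiM_single')
  have "indep_set (sets (vimage_algebra (space \<Omega>) G ?G)) (sets (vimage_algebra (space \<Omega>) Q ?P))"
    using indep_fading_points by (simp add: G_def[abs_def] Q_def[abs_def])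
  moreover have "A \<in> sets (?G \<Otimes>\<^sub>M ?P)"
    unfolding A_def by measurable
  ultimately have "emeasure \<Omega> {\<omega> \<in> space \<Omega>. (G \<omega>, Q \<omega>) \<in> A} =
    (\<integral>\<^sup>+\<omega>'. emeasure \<Omega> {\<omega> \<in> space \<Omega>. (G \<omega>, Q \<omega>') \<in> A} \<partial>\<Omega>)"
    by (intro indep_set_emeasure) auto
  also have "\<dots> = (\<integral>\<^sup>+\<omega>'. ennreal (exp_neg (point_sum K X (\<lambda>x. ln1p (a x)) \<omega>')) \<partial>\<Omega>)"
  proof (rule nn_integral_cong)
    fix \<omega>'
    let ?a = "\<lambda>n. if enat n < K \<omega>' then a (X n \<omega>') else 0"
    have "(if enat n < K \<omega>' then a (X n \<omega>') * y else 0) = ?a n * y" for n y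
      by simp
    then have "{\<omega> \<in> space \<Omega>. (G \<omega>, Q \<omega>') \<in> A} =
        {\<omega> \<in> space \<Omega>. (\<Sum>n. ?a n * ennreal (g n \<omega>)) \<le> ennreal (g\<^sub>0 \<omega>)}"
      by (simp add: A_def G_def Q_def space_pair_measure space_PiM cong: if_cong)
    moreover have "(\<Sum>n. ln1p (?a n)) = point_sum K X (\<lambda>x. ln1p (a x)) \<omega>'"
      unfolding point_sum_def by (intro suminf_cong) simp
    ultimately show "emeasure \<Omega> {\<omega> \<in> space \<Omega>. (G \<omega>, Q \<omega>') \<in> A} =
        ennreal (exp_neg (point_sum K X (\<lambda>x. ln1p (a x)) \<omega>'))"
      by (simp only: fading_coverage)
  qed
  also have "\<dots> = ennreal (exp_neg (\<integral>\<^sup>+x. ennreal (1 - exp_neg (ln1p (a x))) \<partial>\<Lambda>))"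
    by (rule laplace_functional[OF _ fin]) simp
  finally show ?thesis
    by (simp add: A_def G_def Q_def space_pair_measure space_PiM cong: if_cong)
qed

end


subsection \<open>Radial integrals and the shape function\<close>

text \<open>Half-lines \<open>{..r}\<close> generate the Borel sets and are closed under
  intersection. The preimage of \<open>{..r}\<close> is a disc of area
  \<open>pi * r\<^sup>2\<close>, the integral of \<open>2 * pi * t\<close> over
  \<open>{0..r}\<close>.\<close>

lemma distr_norm_plane:
  "distr lborel borel (norm :: real^2 \<Rightarrow> real) =
    density lborel (\<lambda>r. ennreal (2 * pi * r) * indicator {0..} r)" (is "?L = ?R")
proof (rule measure_eqI_generator_eq)
  show "Int_stable (range (\<lambda>r::real. {..r}))"
    by (auto simp: Int_stable_def)
  show "emeasure ?L Z = emeasure ?R Z" if Z: "Z \<in> range (\<lambda>r::real. {..r})" for Z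
  proof -
    obtain r where r: "Z = {..r}" using Z by auto
    have "emeasure ?L Z = emeasure lborel (cball (0 :: real^2) r)"
      unfolding r by (subst emeasure_distr) (auto intro!: arg_cong[where f = "emeasure lborel"])
    also have "\<dots> = ennreal (if r < 0 then 0 else pi * r\<^sup>2)"
      by (cases "r < 0") (simp_all add: emeasure_cball unit_ball_vol_2)
    also have "\<dots> = (\<integral>\<^sup>+t. ennreal (2 * pi * t) * indicator {0..r} t \<partial>lborel)"
    proof (cases "r < 0")
      case False
      have "(\<integral>\<^sup>+t. ennreal (2 * pi * t) * indicator {0..r} t \<partial>lborel) = pi * r\<^sup>2 - pi * 0\<^sup>2"
        using False by (intro nn_integral_FTC_Icc) (auto intro!: derivative_eq_intros)
      then show ?thesis using False by simp
    qed simp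
    also have "\<dots> = emeasure ?R Z"
      unfolding r
      by (subst emeasure_density) (auto intro!: nn_integral_cong simp: indicator_def)
    finally show ?thesis .
  qed
  show "(\<Union>i. {..real i}) = UNIV"
    using real_arch_simple by auto
  show "emeasure ?L {..real i} \<noteq> \<infinity>" for i
  proof -
    have "emeasure ?L {..real i} = emeasure lborel (cball (0 :: real^2) (real i))"
      by (subst emeasure_distr) (auto intro!: arg_cong[where f = "emeasure lborel"])
    then show ?thesis
      by (simp add: emeasure_cball)
  qed
  have "sets (borel :: real measure) = sigma_sets UNIV (range (\<lambda>r::real. {..r}))"
    by (subst borel_eq_atMost) simp
  then show "sets ?L = sigma_sets UNIV (range (\<lambda>r::real. {..r}))"
    "sets ?R = sigma_sets UNIV (range (\<lambda>r::real. {..r}))" by simp_all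
qed auto

lemma nn_integral_radial_plane:
  assumes [measurable]: "\<phi> \<in> borel_measurable borel"
  shows "(\<integral>\<^sup>+x. \<phi> (norm x) \<partial>(lborel :: (real^2) measure)) =
    (\<integral>\<^sup>+r. ennreal (2 * pi * r) * indicator {0..} r * \<phi> r \<partial>lborel)"
proof -
  have "(\<integral>\<^sup>+x. \<phi> (norm x) \<partial>(lborel :: (real^2) measure)) = (\<integral>\<^sup>+r. \<phi> r \<partial>distr lborel borel (norm :: real^2 \<Rightarrow> real))"
    by (rule nn_integral_distr[symmetric]) auto
  also have "\<dots> = (\<integral>\<^sup>+r. ennreal (2 * pi * r) * indicator {0..} r * \<phi> r \<partial>lborel)"
    unfolding distr_norm_plane by (rule nn_integral_density) auto
  finally show ?thesis .
qed

section \<open>The kernel integral \<open>J\<close>: relation to \<open>A2_origin\<close>,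
  positivity, behaviour at 0\<close>

locale shape_function =
  fixes F f :: "real \<Rightarrow> real"
  assumes range: "\<And>r. 0 \<le> r \<Longrightarrow> F r \<in> {0..1}"
    and deriv: "\<And>r. 0 \<le> r \<Longrightarrow> (F has_real_derivative f r) (at r within {0..})"
    and nonzero: "\<exists>r\<ge>0. F r \<noteq> 0"
    and vanishes: "(F \<longlongrightarrow> 0) at_top"
begin

text \<open>In polar coordinates \<open>pi * J v\<close> is the planar integral of
  \<open>F (norm x) / ((norm x)\<^sup>2 + v)\<close>. The kernel
  \<open>2 * r / (r\<^sup>2 + v)\<close> is the derivative of
  \<open>ln (r\<^sup>2 + v)\<close>.\<close>

definition J :: "real \<Rightarrow> real" where
  "J v = integral {0..} (\<lambda>r. F r * (2 * r / (r\<^sup>2 + v)))"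

lemma nonneg: "0 \<le> r \<Longrightarrow> 0 \<le> F r" and le_1: "0 \<le> r \<Longrightarrow> F r \<le> 1"
  using range[of r] by auto

lemma continuous: "continuous_on {0..} F"
  using deriv by (intro DERIV_continuous_on) auto

lemma continuous_kernel:
  "0 < v \<Longrightarrow> continuous_on {0..} (\<lambda>r. F r * (2 * r / (r\<^sup>2 + v)))"
  using continuous by (intro continuous_intros) (auto simp: add_nonneg_eq_0_iff)

lemma integrable_kernel_Icc:
  assumes "0 < v" "0 \<le> a"
  shows "(\<lambda>r. F r * (2 * r / (r\<^sup>2 + v))) integrable_on {a..b}"
  using assms by (intro integrable_continuous_real continuous_on_subset[OF continuous_kernel]) auto

text \<open>
  The weight \<open>ln (r\<^sup>2 + u)\<close> is increasing and nonnegative for \<open>r \<ge> 1\<close>, so it can be moved inside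
  \<open>F y = - \<integral> f\<close> over \<open>[y, \<infinity>)\<close>, which bounds the boundary term by a tail of the integral of
  \<open>\<bar>f r * ln (r\<^sup>2 + u)\<bar>\<close>.  Only \<open>f\<close> times the weight is Lebesgue integrable: if \<open>u < 1\<close>, \<open>f\<close> itself
  need not be so near the zero of the weight.
\<close>

lemma tendsto_ln_weight:
  assumes "0 < u" and int: "set_integrable lborel {0..} (\<lambda>r. f r * ln (r\<^sup>2 + u))"
  shows "((\<lambda>r. F r * ln (r\<^sup>2 + u)) \<longlongrightarrow> 0) at_top"
proof -
  define h where "h r = \<bar>f r * ln (r\<^sup>2 + u)\<bar>" for r
  have h: "set_integrable lborel {0..} h"
    unfolding h_def using int by (rule set_integrable_abs)
  have h_sub: "set_integrable lborel {a..b} h" if "0 \<le> a" for a b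
    using h by (rule set_integrable_subset) (use that in auto)
  define T where "T y = integral {0..} h - integral {0..y} h" for y
  have eq: "(LBINT r:{0..y}. h r) = integral {0..y} h" "(LBINT r:{0..}. h r) = integral {0..} h" for y
    using set_borel_integral_eq_integral(2)[OF h_sub[of 0 y]] set_borel_integral_eq_integral(2)[OF h]
    by simp_all
  have "((\<lambda>y. integral {0..y} h) \<longlongrightarrow> integral {0..} h) at_top"
    using tendsto_set_lebesgue_integral_at_top[of 0 lborel h] h by (simp add: eq)
  then have "(T \<longlongrightarrow> integral {0..} h - integral {0..} h) at_top"
    unfolding T_def by (intro tendsto_intros)
  then have T: "(T \<longlongrightarrow> 0) at_top" by simp
  have bound: "F y * ln (y\<^sup>2 + u) \<le> T y" if y: "1 \<le> y" for y
  proof -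
    have le: "ln (y\<^sup>2 + u) * (F y - F t) \<le> T y" if t: "y \<le> t" for t
    proof -
      have f: "(f has_integral F t - F y) {y..t}"
        using y t by (intro fundamental_theorem_of_calculus)
          (auto simp flip: has_real_derivative_iff_has_vector_derivative intro: DERIV_subset[OF deriv])
      have "norm (integral {y..t} (\<lambda>r. ln (y\<^sup>2 + u) * f r)) \<le> integral {y..t} h"
      proof (rule integral_norm_bound_integral)
        show "(\<lambda>r. ln (y\<^sup>2 + u) * f r) integrable_on {y..t}"
          using has_integral_mult_right[OF f] by blast
        show "h integrable_on {y..t}"
          using y by (intro set_borel_integral_eq_integral h_sub) simp
        fix r assume r: "r \<in> {y..t}"
        have "1 \<le> y\<^sup>2" using y by simp
        moreover have "y\<^sup>2 \<le> r\<^sup>2" using r y by (intro power_mono) auto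
        ultimately have "0 \<le> ln (y\<^sup>2 + u)" "ln (y\<^sup>2 + u) \<le> ln (r\<^sup>2 + u)"
          using \<open>0 < u\<close> by auto
        then show "norm (ln (y\<^sup>2 + u) * f r) \<le> h r"
          by (simp add: h_def abs_mult mult.commute mult_left_mono)
      qed
      moreover have "integral {y..t} (\<lambda>r. ln (y\<^sup>2 + u) * f r) = ln (y\<^sup>2 + u) * (F t - F y)"
        using has_integral_mult_right[OF f] by (rule integral_unique)
      moreover have "integral {0..y} h + integral {y..t} h = integral {0..t} h"
        using y t by (intro Henstock_Kurzweil_Integration.integral_combine
            set_borel_integral_eq_integral h_sub) auto
      moreover have "integral {0..t} h \<le> integral {0..} h"
        using h_sub[of 0 t] h by (intro integral_subset_le set_borel_integral_eq_integral)
          (auto simp: h_def)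
      ultimately show ?thesis
        by (simp add: T_def right_diff_distrib abs_le_iff)
    qed
    have lim: "((\<lambda>t. ln (y\<^sup>2 + u) * (F y - F t)) \<longlongrightarrow> ln (y\<^sup>2 + u) * (F y - 0)) at_top"
      by (rule tendsto_mult_left[OF tendsto_diff[OF tendsto_const vanishes]])
    have "ln (y\<^sup>2 + u) * (F y - 0) \<le> T y"
      by (rule tendsto_upperbound[OF lim eventually_at_top_linorderI[OF le]]) simp_all
    then show ?thesis by (simp add: mult.commute)
  qed
  show ?thesis
  proof (rule tendsto_sandwich[OF _ _ tendsto_const T])
    show "eventually (\<lambda>y. F y * ln (y\<^sup>2 + u) \<le> T y) at_top"
      using bound by (rule eventually_at_top_linorderI)
    show "eventually (\<lambda>y. 0 \<le> F y * ln (y\<^sup>2 + u)) at_top"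
    proof (rule eventually_at_top_linorderI)
      fix y :: real assume "1 \<le> y"
      then have "1 \<le> y\<^sup>2 + u" using \<open>0 < u\<close> one_le_power[of y 2] by linarith
      then show "0 \<le> F y * ln (y\<^sup>2 + u)"
        using \<open>1 \<le> y\<close> nonneg[of y] by simp
    qed
  qed
qed

text \<open>Since the kernel integrand is nonnegative, convergence of its integrals over
  \<open>{0..y}\<close> already yields integrability on the half-line. Parts on
  \<open>{0..y}\<close> leave a boundary term at \<open>y\<close>, which
  \<open>tendsto_ln_weight\<close> removes.\<close>

lemma has_integral_A2_origin:
  assumes "0 < u" and int: "set_integrable lborel {0..} (\<lambda>r. f r * ln (r\<^sup>2 + u))"
  shows "((\<lambda>r. F r * (2 * r / (r\<^sup>2 + u))) has_integral A2_origin F f u / pi) {0..}"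
proof (rule has_integral_to_inf)
  let ?h = "\<lambda>r. F r * (2 * r / (r\<^sup>2 + u))" and ?p = "\<lambda>r. f r * ln (r\<^sup>2 + u)"
  show "?h integrable_on {0..y}" for y
    using \<open>0 < u\<close> by (intro integrable_kernel_Icc) auto
  show "0 \<le> ?h y" if "0 \<le> y" for y
    using nonneg[OF that] that \<open>0 < u\<close> by simp
  have sub: "set_integrable lborel {0..y} ?p" for y
    using int by (rule set_integrable_subset) auto
  have parts: "F y * ln (y\<^sup>2 + u) - F 0 * ln u - (LBINT r:{0..y}. ?p r) = integral {0..y} ?h"
    if "0 \<le> y" for y
  proof -
    have "((\<lambda>r. ?p r + ?h r) has_integral F y * ln (y\<^sup>2 + u) - F 0 * ln (0\<^sup>2 + u)) {0..y}"
    proof (rule fundamental_theorem_of_calculus)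
      fix r assume r: "r \<in> {0..y}"
      then have F: "(F has_real_derivative f r) (at r within {0..y})"
        by (intro DERIV_subset[OF deriv]) auto
      have "0 < r\<^sup>2 + u" using \<open>0 < u\<close> by (simp add: add_nonneg_pos)
      then show "((\<lambda>r. F r * ln (r\<^sup>2 + u)) has_vector_derivative ?p r + ?h r) (at r within {0..y})"
        unfolding has_real_derivative_iff_has_vector_derivative[symmetric]
        by (auto intro!: derivative_eq_intros F)
    qed fact
    from has_integral_diff[OF this integrable_integral[OF set_borel_integral_eq_integral(1)[OF sub]]]
    have "(?h has_integral F y * ln (y\<^sup>2 + u) - F 0 * ln u - integral {0..y} ?p) {0..y}"
      by simp
    from integral_unique[OF this] show ?thesis
      using set_borel_integral_eq_integral(2)[OF sub, of y] by simp
  qed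
  have "((\<lambda>y. F y * ln (y\<^sup>2 + u) - F 0 * ln u - (LBINT r:{0..y}. ?p r)) \<longlongrightarrow>
      0 - F 0 * ln u - (LBINT r:{0..}. ?p r)) at_top"
    using int by (intro tendsto_intros tendsto_ln_weight[OF assms] tendsto_set_lebesgue_integral_at_top) auto
  moreover have "eventually (\<lambda>y. F y * ln (y\<^sup>2 + u) - F 0 * ln u - (LBINT r:{0..y}. ?p r) =
      integral {0..y} ?h) at_top"
    using parts by (rule eventually_at_top_linorderI)
  moreover have "0 - F 0 * ln u - (LBINT r:{0..}. ?p r) = A2_origin F f u / pi"
    by (simp add: A2_origin_def)
  ultimately show "((\<lambda>y. integral {0..y} ?h) \<longlongrightarrow> A2_origin F f u / pi) at_top"
    by (simp add: tendsto_cong)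
qed

context
  fixes u :: real
  assumes u: "0 < u" and integrable_u: "(\<lambda>r. F r * (2 * r / (r\<^sup>2 + u))) integrable_on {0..}"
begin

text \<open>Lowering \<open>u\<close> to \<open>v\<close> enlarges the kernel by at most the factor
  \<open>u / v\<close>, uniformly in \<open>r\<close>.\<close>

lemma integrable_kernel:
  assumes "0 < v" "v \<le> u"
  shows "(\<lambda>r. F r * (2 * r / (r\<^sup>2 + v))) integrable_on {0..}"
proof (rule measurable_bounded_by_integrable_imp_integrable)
  show "(\<lambda>r. F r * (2 * r / (r\<^sup>2 + v))) \<in> borel_measurable (lebesgue_on {0..})"
    using \<open>0 < v\<close> by (intro continuous_imp_measurable_on_sets_lebesgue continuous_kernel) auto
  show "(\<lambda>r. u / v * (F r * (2 * r / (r\<^sup>2 + u)))) integrable_on {0..}"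
    using integrable_u by (rule integrable_on_mult_right)
  fix r :: real assume "r \<in> {0..}"
  then have r: "0 \<le> r" by simp
  have "r\<^sup>2 * v \<le> r\<^sup>2 * u" using assms by (intro mult_left_mono) auto
  then have "1 / (r\<^sup>2 + v) \<le> u / v * (1 / (r\<^sup>2 + u))"
    using assms u by (simp add: field_simps add_pos_nonneg)
  then have "(F r * 2 * r) * (1 / (r\<^sup>2 + v)) \<le> (F r * 2 * r) * (u / v * (1 / (r\<^sup>2 + u)))"
    using nonneg r by (intro mult_left_mono) auto
  moreover have "0 \<le> F r * (2 * r / (r\<^sup>2 + v))"
    using nonneg r assms by simp
  ultimately show "norm (F r * (2 * r / (r\<^sup>2 + v))) \<le> u / v * (F r * (2 * r / (r\<^sup>2 + u)))"
    by (simp add: mult_ac del: abs_mult abs_divide)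
qed auto

lemma J_antimono:
  assumes "0 < v" "v \<le> u"
  shows "J u \<le> J v"
  unfolding J_def
proof (rule integral_le[OF integrable_u integrable_kernel[OF assms]])
  fix r :: real assume "r \<in> {0..}"
  then show "F r * (2 * r / (r\<^sup>2 + u)) \<le> F r * (2 * r / (r\<^sup>2 + v))"
    using nonneg[of r] assms by (intro mult_left_mono divide_left_mono) (auto simp: add_nonneg_pos)
qed

text \<open>By continuity \<open>F\<close> cannot be nonzero at 0 only, so the integrand is nonzero
  at some positive \<open>r\<close>; being continuous and nonnegative, it has a positive integral
  over \<open>{r..r+1}\<close>. This permits dividing by \<open>J u\<close>.\<close>

lemma J_pos: "0 < J u"
proof -
  have "\<exists>r>0. F r \<noteq> 0"
  proof (rule ccontr)
    assume "\<not> (\<exists>r>0. F r \<noteq> 0)"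
    then have zero: "F r = 0" if "0 < r" for r
      using that by blast
    have "(F \<longlongrightarrow> F 0) (at_right 0)"
      using continuous by (auto simp: continuous_on_def simp flip: at_within_Ici_at_right)
    moreover have "(F \<longlongrightarrow> 0) (at_right 0)"
      using zero by (intro tendsto_eventually) (auto simp: eventually_at_filter)
    ultimately have "F 0 = 0"
      using tendsto_unique trivial_limit_at_right_real by blast
    then show False
      using zero nonzero by (metis order_le_less)
  qed
  then obtain r where r: "0 < r" "F r \<noteq> 0" by blast
  let ?h = "\<lambda>r. F r * (2 * r / (r\<^sup>2 + u))"
  have h: "0 \<le> ?h t" if "0 \<le> t" for t
    using nonneg[OF that] that u by simp
  have cont: "continuous_on {r..r+1} ?h"
    using r by (intro continuous_on_subset[OF continuous_kernel[OF u]]) auto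
  have "?h r \<noteq> 0"
    using r u by (simp add: add_nonneg_eq_0_iff)
  moreover have "integral {r..r+1} ?h = 0 \<longleftrightarrow> (\<forall>t\<in>{r..r+1}. ?h t = 0)"
    by (rule integral_eq_0_iff[OF cont]) (use r h in simp_all)
  ultimately have "integral {r..r+1} ?h \<noteq> 0"
    by force
  moreover have "0 \<le> integral {r..r+1} ?h"
    using r h by (intro Henstock_Kurzweil_Integration.integral_nonneg integrable_kernel_Icc u) auto
  moreover have "integral {r..r+1} ?h \<le> J u"
    unfolding J_def using r h by (intro integral_subset_le integrable_kernel_Icc u integrable_u) auto
  ultimately show ?thesis by linarith
qed

text \<open>Below \<open>\<delta>\<close> the difference quotient at 0 is within 1 of
  \<open>f 0\<close>, giving the slope \<open>\<bar>f 0\<bar> + 1\<close>; from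
  \<open>\<delta>\<close> on, the trivial bound \<open>1 \<le> r / \<delta>\<close>
  suffices.\<close>

lemma Lipschitz_at_0: "\<exists>L\<ge>0. \<forall>r\<in>{0..1}. \<bar>F r - F 0\<bar> \<le> L * r"
proof -
  have "((\<lambda>r. (F r - F 0) / (r - 0)) \<longlongrightarrow> f 0) (at 0 within {0..})"
    using deriv[of 0] by (simp add: has_field_derivative_iff)
  then have "eventually (\<lambda>r. dist ((F r - F 0) / (r - 0)) (f 0) < 1) (at 0 within {0..})"
    by (rule tendstoD) simp
  then obtain \<delta> where \<delta>: "0 < \<delta>"
      "\<And>r. 0 < r \<Longrightarrow> r < \<delta> \<Longrightarrow> \<bar>(F r - F 0) / r - f 0\<bar> < 1"
    unfolding eventually_at by (auto simp: dist_real_def)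
  have "\<bar>F r - F 0\<bar> \<le> (\<bar>f 0\<bar> + 1 + 1 / \<delta>) * r" if r: "r \<in> {0..1}" for r
  proof (cases "r = 0 \<or> \<delta> \<le> r")
    case False
    then have "\<bar>(F r - F 0) / r\<bar> \<le> \<bar>f 0\<bar> + 1"
      using \<delta>(2)[of r] r by auto
    then have "\<bar>F r - F 0\<bar> \<le> (\<bar>f 0\<bar> + 1) * r"
      using False r by (simp add: field_simps)
    also have "\<dots> \<le> (\<bar>f 0\<bar> + 1 + 1 / \<delta>) * r"
      using r \<delta>(1) by (intro mult_right_mono) auto
    finally show ?thesis .
  next
    case True
    have "\<bar>F r - F 0\<bar> \<le> 1" if "r \<noteq> 0"
      using range[of r] range[of 0] r by auto
    moreover have "1 \<le> 1 / \<delta> * r" if "r \<noteq> 0"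
      using True \<delta>(1) that by (simp add: field_simps)
    moreover have "1 / \<delta> * r \<le> (\<bar>f 0\<bar> + 1 + 1 / \<delta>) * r"
      using r \<delta>(1) by (intro mult_right_mono) auto
    ultimately show ?thesis by (cases "r = 0") auto
  qed
  then show ?thesis
    using \<delta>(1) by (intro exI[of _ "\<bar>f 0\<bar> + 1 + 1 / \<delta>"]) auto
qed

text \<open>
  The logarithm comes from \<open>F 0\<close> times the kernel on \<open>[0, 1]\<close>; the Lipschitz remainder there and the
  integral over \<open>[1, \<infinity>)\<close> are bounded uniformly in \<open>v\<close>.
\<close>

lemma J_asymptotics: "\<exists>C. \<forall>v. 0 < v \<and> v \<le> u \<longrightarrow> \<bar>J v + F 0 * ln v\<bar> \<le> C"
proof -
  obtain L where L: "0 \<le> L" "\<And>r. r \<in> {0..1} \<Longrightarrow> \<bar>F r - F 0\<bar> \<le> L * r"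
    using Lipschitz_at_0 by blast
  \<comment> \<open>The three constants bound the Lipschitz remainder on \<open>{0..1}\<close>, the
    term \<open>F 0 * ln (1 + v)\<close> left by the exact integral \<open>ln (1 + v) - ln v\<close>
    of the kernel, and the integral over \<open>{1..}\<close>.\<close>
  have "\<bar>J v + F 0 * ln v\<bar> \<le> 2 * L + ln (1 + u) + (1 + u) * J u" if v: "0 < v" "v \<le> u" for v
  proof -
    let ?k = "\<lambda>v r. 2 * r / (r\<^sup>2 + v)"
    let ?h = "\<lambda>v r. F r * ?k v r"
    have pos: "0 < r\<^sup>2 + v" "0 < r\<^sup>2 + u" for r
      using v u by (simp_all add: add_nonneg_pos)
    have h: "0 \<le> ?h v r" "0 \<le> ?h u r" if "0 \<le> r" for r
      using nonneg[OF that] that v u by simp_all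
    have int1: "?h w integrable_on {1..}" if "0 < w" "w \<le> u" for w
    proof -
      \<comment> \<open>Nonnegativity upgrades to absolute integrability, which restricts to
        subsets.\<close>
      have "?h w absolutely_integrable_on {0..}"
        using nonneg that by (intro nonnegative_absolutely_integrable_1 integrable_kernel) auto
      then have "?h w absolutely_integrable_on {1..}"
        by (rule set_integrable_subset) auto
      then show ?thesis
        by (rule set_lebesgue_integral_eq_integral)
    qed
    have "(?h v has_integral integral {0..1} (?h v) + integral {1..} (?h v)) ({0..1} \<union> {1..})"
    proof (rule has_integral_Un)
      have "{0..1} \<inter> {1::real..} = {1}" by auto
      then show "negligible ({0..1} \<inter> {1::real..})" by simp
    qed (intro integrable_integral integrable_kernel_Icc int1 v order_refl)+
    moreover have "{0..1} \<union> {1..} = {0::real..}" by auto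
    ultimately have split: "J v = integral {0..1} (?h v) + integral {1..} (?h v)"
      unfolding J_def by (simp only: integral_unique)
    have k: "(?k v has_integral ln (1\<^sup>2 + v) - ln (0\<^sup>2 + v)) {0..1}"
    proof (rule fundamental_theorem_of_calculus)
      fix r :: real
      show "((\<lambda>r. ln (r\<^sup>2 + v)) has_vector_derivative ?k v r) (at r within {0..1})"
        unfolding has_real_derivative_iff_has_vector_derivative[symmetric]
        using pos[of r] by (auto intro!: derivative_eq_intros)
    qed simp
    have "(?h v has_integral integral {0..1} (?h v)) {0..1}"
      using v by (intro integrable_integral integrable_kernel_Icc) auto
    from has_integral_diff[OF this has_integral_mult_right[OF k, of "F 0"]]
    have near: "((\<lambda>r. (F r - F 0) * ?k v r) has_integral
        integral {0..1} (?h v) - F 0 * (ln (1 + v) - ln v)) {0..1}"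
      by (simp add: left_diff_distrib diff_divide_distrib)
    have "norm (integral {0..1} (\<lambda>r. (F r - F 0) * ?k v r)) \<le> integral {0..1::real} (\<lambda>_. 2 * L)"
    proof (rule integral_norm_bound_integral[OF has_integral_integrable[OF near] integrable_const_ivl])
      fix r :: real assume r: "r \<in> {0..1}"
      have "norm ((F r - F 0) * ?k v r) \<le> (L * r) * ?k v r"
        using L(2)[OF r] r pos[of r] by (simp add: abs_mult mult_right_mono divide_right_mono)
      also have "\<dots> = 2 * L * (r\<^sup>2 / (r\<^sup>2 + v))"
        by (simp add: power2_eq_square)
      also have "\<dots> \<le> 2 * L * 1"
        using L(1) v pos[of r] by (intro mult_left_mono) auto
      finally show "norm ((F r - F 0) * ?k v r) \<le> 2 * L" by simp
    qed
    then have "\<bar>integral {0..1} (?h v) - F 0 * (ln (1 + v) - ln v)\<bar> \<le> 2 * L"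
      unfolding integral_unique[OF near] by simp
    moreover have "0 \<le> integral {1..} (?h v)"
      using h by (intro Henstock_Kurzweil_Integration.integral_nonneg int1 v) auto
    moreover have "integral {1..} (?h v) \<le> (1 + u) * J u"
    proof -
      \<comment> \<open>For \<open>r \<ge> 1\<close>, \<open>u \<le> u * r\<^sup>2\<close> gives
        \<open>r\<^sup>2 + u \<le> (1 + u) * (r\<^sup>2 + v)\<close>: away from 0 the kernels are
        comparable with a factor free of \<open>v\<close>.\<close>
      have "integral {1..} (?h v) \<le> integral {1..} (\<lambda>r. (1 + u) * ?h u r)"
      proof (rule integral_le)
        show "(\<lambda>r. (1 + u) * ?h u r) integrable_on {1..}"
          using u by (intro integrable_on_mult_right int1) auto
        fix r :: real assume "r \<in> {1..}"
        then have r: "1 \<le> r" by simp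
        have "1 \<le> r\<^sup>2" using r by simp
        then have "u \<le> u * r\<^sup>2" using u by simp
        moreover have "0 \<le> u * v" using u v by simp
        ultimately have "r\<^sup>2 + u \<le> (1 + u) * (r\<^sup>2 + v)"
          unfolding distrib_left distrib_right using v by linarith
        then have "1 / (r\<^sup>2 + v) \<le> (1 + u) * (1 / (r\<^sup>2 + u))"
          using pos[of r] by (simp add: field_simps)
        then have "(F r * 2 * r) * (1 / (r\<^sup>2 + v)) \<le> (F r * 2 * r) * ((1 + u) * (1 / (r\<^sup>2 + u)))"
          using nonneg[of r] r by (intro mult_left_mono) auto
        then show "?h v r \<le> (1 + u) * ?h u r"
          by (simp add: mult_ac)
      qed (intro int1 v)
      also have "\<dots> = (1 + u) * integral {1..} (?h u)"
        by (rule integral_mult_right)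
      also have "\<dots> \<le> (1 + u) * J u"
        unfolding J_def using u h
        by (intro mult_left_mono integral_subset_le int1 integrable_u) auto
      finally show ?thesis .
    qed
    moreover have "0 \<le> F 0 * ln (1 + v)" "F 0 * ln (1 + v) \<le> 1 * ln (1 + u)"
      using nonneg[of 0] le_1[of 0] v by (intro mult_nonneg_nonneg mult_mono; simp)+
    ultimately show ?thesis
      unfolding split by (simp add: right_diff_distrib abs_le_iff)
  qed
  then show ?thesis by blast
qed

end

end


subsection \<open>Outage probability and capacity\<close>

text \<open>Clearing the denominator is safe at both extremes: \<open>W = 0\<close> makes the
  quotient \<open>\<top>\<close>, hence no outage, and \<open>W = \<top>\<close> makes it 0, hence
  an outage.\<close>

lemma sinr_less_iff:
  assumes "0 < y" "0 < b"
  shows "ennreal y / (1 / \<infinity> + W) < ennreal b \<longleftrightarrow> \<not> ennreal b * W \<le> ennreal y"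
proof (cases W)
  case (real w)
  show ?thesis
  proof (cases "w = 0")
    case True
    then show ?thesis
      using assms real by (simp add: ennreal_divide_zero ennreal_eq_0_iff)
  next
    case False
    with real assms show ?thesis
      by (simp add: divide_ennreal ennreal_less_iff pos_divide_less_eq not_le flip: ennreal_mult)
  qed
next
  case top
  then show ?thesis
    using assms by (simp add: ennreal_mult_top top_unique)
qed

context shape_function
begin

text \<open>\<open>F\<close> is controlled only on \<open>{0..}\<close>; composing with
  \<open>max 0\<close> gives a continuous function on the whole line that agrees with
  \<open>F\<close> on norms.\<close>

lemma measurable_radial [measurable]: "(\<lambda>x::real^2. F (norm x)) \<in> borel_measurable borel"
  and measurable_max [measurable]: "(\<lambda>r. F (max 0 r)) \<in> borel_measurable borel"
proof -
  show *: "(\<lambda>r. F (max 0 r)) \<in> borel_measurable borel"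
    by (intro borel_measurable_continuous_onI continuous_on_compose2[OF continuous] continuous_intros) auto
  have "(\<lambda>x::real^2. F (max 0 (norm x))) \<in> borel_measurable borel"
    using * by measurable
  then show "(\<lambda>x::real^2. F (norm x)) \<in> borel_measurable borel"
    by simp
qed

lemma isotropic_intensity_ball:
  assumes "0 < l"
  shows "emeasure (isotropic_intensity l F) (ball 0 R) < \<infinity>"
proof -
  have "emeasure (isotropic_intensity l F) (ball 0 R) =
      (\<integral>\<^sup>+x. ennreal (l * F (norm x)) * indicator (ball 0 R) (x :: real^2) \<partial>lborel)"
    unfolding isotropic_intensity_def by (subst emeasure_density) auto
  also have "\<dots> \<le> (\<integral>\<^sup>+x. ennreal l * indicator (ball 0 R) (x :: real^2) \<partial>lborel)"
    using le_1 assms by (intro nn_integral_mono mult_right_mono ennreal_leI) auto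
  also have "\<dots> = ennreal l * emeasure lborel (ball (0 :: real^2) R)"
    by (simp add: nn_integral_cmult_indicator)
  also have "\<dots> < \<infinity>"
    using emeasure_bounded_finite[of "ball (0 :: real^2) R"] by (simp add: ennreal_mult_less_top)
  finally show ?thesis .
qed

lemma nn_integral_isotropic_intensity:
  assumes "0 < l" "0 < s" and int: "(\<lambda>r. F r * (2 * r / (r\<^sup>2 + s))) integrable_on {0..}"
  shows "(\<integral>\<^sup>+x. ennreal (s / ((norm x)\<^sup>2 + s)) \<partial>isotropic_intensity l F) = ennreal (l * pi * s * J s)"
proof -
  have "(\<integral>\<^sup>+x. ennreal (s / ((norm x)\<^sup>2 + s)) \<partial>isotropic_intensity l F) =
      (\<integral>\<^sup>+(x::real^2). ennreal (l * F (norm x)) * ennreal (s / ((norm x)\<^sup>2 + s)) \<partial>lborel)"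
    unfolding isotropic_intensity_def by (rule nn_integral_density) auto
  \<comment> \<open>The radial formula requires a Borel function on all of the line, which
    \<open>F\<close> itself need not be.\<close>
  also have "\<dots> = (\<integral>\<^sup>+(x::real^2). ennreal (l * F (max 0 (norm x))) * ennreal (s / ((norm x)\<^sup>2 + s)) \<partial>lborel)"
    by simp
  also have "\<dots> = (\<integral>\<^sup>+r. ennreal (2 * pi * r) * indicator {0..} r *
      (ennreal (l * F (max 0 r)) * ennreal (s / (r\<^sup>2 + s))) \<partial>lborel)"
    by (rule nn_integral_radial_plane) measurable
  also have "\<dots> = (\<integral>\<^sup>+r. ennreal (l * pi * s * (F r * (2 * r / (r\<^sup>2 + s)))) * indicator {0..} r \<partial>lborel)"
    using nonneg assms
    by (intro nn_integral_cong) (auto simp: indicator_def mult_ac simp flip: ennreal_mult)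
  also have "\<dots> = ennreal (l * pi * s * J s)"
    unfolding J_def using nonneg assms
    by (intro nn_integral_has_integral_lebesgue' has_integral_mult_right integrable_integral) auto
  finally show ?thesis .
qed

text \<open>Coverage is the event of \<open>coverage_probability\<close> with weight
  \<open>s\<close> times the path loss, \<open>s = b * d\<^sup>2\<close>. For exponent 2 the Laplace
  integrand is \<open>s / ((norm x)\<^sup>2 + s)\<close>, whose integral against the intensity is
  \<open>l * pi * s * J s\<close>.\<close>

theorem outage_probability_rayleigh:
  assumes "rayleigh_network \<Omega> (isotropic_intensity l F) K X g g\<^sub>0"
    and "0 < l" "0 < b" "0 < d"
    and int: "(\<lambda>r. F r * (2 * r / (r\<^sup>2 + b * d\<^sup>2))) integrable_on {0..}"
  shows "outage_probability \<Omega> 0 2 \<infinity> d K X g g\<^sub>0 b = 1 - exp (- (l * pi * (b * d\<^sup>2) * J (b * d\<^sup>2)))"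
proof -
  interpret rayleigh_network \<Omega> "isotropic_intensity l F" K X g g\<^sub>0 by fact
  note [measurable] = measurable_K measurable_X
  define s where "s = b * d\<^sup>2"
  have s: "0 < s" using assms by (simp add: s_def)
  define a where "a x = ennreal s * path_loss 0 2 (norm x)" for x :: "real^2"
  have [measurable]: "a \<in> borel_measurable borel"
    unfolding a_def[abs_def] path_loss_def by measurable
  \<comment> \<open>At \<open>x = 0\<close> the path loss is \<open>\<top>\<close>, and both sides
    equal 1.\<close>
  have ln1p_a: "1 - exp_neg (ln1p (a x)) = s / ((norm x)\<^sup>2 + s)" for x
  proof (cases "x = 0")
    case True
    then show ?thesis
      using s by (simp add: a_def path_loss_def ennreal_mult_top)
  next
    case False
    then have "a x = ennreal (s / (norm x)\<^sup>2)"
      using s by (simp add: a_def path_loss_def inverse_ennreal powr_numeral divide_inverse flip: ennreal_mult)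
    moreover have "1 - 1 / (1 + s / n) = s / (n + s)" if "0 < n" for n
      using s that by (simp add: divide_simps)
    ultimately show ?thesis
      using s False by (simp add: exp_neg_ln1p)
  qed
  define I where "I = interference 0 2 K X g"
  have [measurable]: "I \<in> borel_measurable \<Omega>"
    unfolding I_def interference_def[abs_def] path_loss_def by measurable
  have d: "inverse (path_loss 0 2 d) = ennreal (d\<^sup>2)"
    using \<open>0 < d\<close> by (simp add: path_loss_def powr_numeral inverse_ennreal)
  have sum: "(\<Sum>n. if enat n < K \<omega> then a (X n \<omega>) * ennreal (g n \<omega>) else 0) = ennreal b * (ennreal (d\<^sup>2) * I \<omega>)" for \<omega>
    unfolding I_def interference_def ennreal_suminf_cmult[symmetric]
    using assms by (intro suminf_cong) (simp add: a_def s_def ennreal_mult mult_ac)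
  let ?C = "{\<omega> \<in> space \<Omega>. ennreal b * (ennreal (d\<^sup>2) * I \<omega>) \<le> ennreal (g\<^sub>0 \<omega>)}"
  have "emeasure \<Omega> ?C = ennreal (exp_neg (\<integral>\<^sup>+x. ennreal (1 - exp_neg (ln1p (a x))) \<partial>isotropic_intensity l F))"
    unfolding sum[symmetric] using \<open>0 < l\<close> by (intro coverage_probability isotropic_intensity_ball) auto
  also have "\<dots> = ennreal (exp (- (l * pi * s * J s)))"
  proof -
    have "0 \<le> J s"
      unfolding J_def using int nonneg s
      by (intro Henstock_Kurzweil_Integration.integral_nonneg) (auto simp: s_def)
    then show ?thesis
      unfolding ln1p_a using assms s
      by (subst nn_integral_isotropic_intensity) (auto simp: s_def)
  qed
  finally have C: "prob ?C = exp (- (l * pi * s * J s))"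
    by (simp add: emeasure_eq_measure)
  have "outage_probability \<Omega> 0 2 \<infinity> d K X g g\<^sub>0 b = prob (space \<Omega> - ?C)"
    unfolding outage_probability_def
  \<comment> \<open>The two events agree only where \<open>g\<^sub>0\<close> is positive, which
    holds almost surely.\<close>
  proof (rule finite_measure_eq_AE)
    show "AE \<omega> in \<Omega>. \<omega> \<in> {\<omega> \<in> space \<Omega>. sinr 0 2 \<infinity> d K X g g\<^sub>0 \<omega> < ennreal b} \<longleftrightarrow> \<omega> \<in> space \<Omega> - ?C"
      using AE_fading_pos
    proof eventually_elim
      case (elim \<omega>)
      then show ?case
        using sinr_less_iff[OF _ \<open>0 < b\<close>, of "g\<^sub>0 \<omega>" "ennreal (d\<^sup>2) * I \<omega>"]
        by (auto simp: sinr_def I_def d)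
    qed
    show "{\<omega> \<in> space \<Omega>. sinr 0 2 \<infinity> d K X g g\<^sub>0 \<omega> < ennreal b} \<in> events"
      unfolding sinr_def I_def[symmetric] by measurable
  qed measurable
  also have "\<dots> = 1 - prob ?C"
    by (rule prob_compl) measurable
  finally show ?thesis
    by (simp add: C s_def)
qed

end

section \<open>Maximal density and the capacity gain\<close>

text \<open>Taking logarithms, the admissible densities form a half-open interval starting at 0
  whose positive right endpoint is included, so the greatest element exists.\<close>

lemma max_density_exp:
  assumes "\<And>l. 0 < l \<Longrightarrow> P l = 1 - exp (- (l * c))" "0 < c" "0 < \<epsilon>" "\<epsilon> < 1"
  shows "max_density P \<epsilon> = - ln (1 - \<epsilon>) / c"
proof -
  have le_iff: "P l \<le> \<epsilon> \<longleftrightarrow> l \<le> - ln (1 - \<epsilon>) / c" if "0 < l" for l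
  proof -
    have "P l \<le> \<epsilon> \<longleftrightarrow> ln (1 - \<epsilon>) \<le> - (l * c)"
      using assms that ln_le_cancel_iff[of "1 - \<epsilon>" "exp (- (l * c))"] by auto
    then show ?thesis
      using pos_le_divide_eq[OF \<open>0 < c\<close>, of l "- ln (1 - \<epsilon>)"] by linarith
  qed
  have "0 < - ln (1 - \<epsilon>) / c"
    using assms by (simp add: divide_neg_pos)
  then show ?thesis
    unfolding max_density_def by (intro Greatest_equality) (auto simp: le_iff)
qed

theorem corollary7:
  fixes F f :: "real \<Rightarrow> real"
    and d \<beta> \<epsilon> :: real
    and \<Omega> :: "real \<Rightarrow> 'w measure"
    and K :: "real \<Rightarrow> 'w \<Rightarrow> enat"
    and X :: "real \<Rightarrow> nat \<Rightarrow> 'w \<Rightarrow> real^2"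
    and g :: "real \<Rightarrow> nat \<Rightarrow> 'w \<Rightarrow> real"
    and g\<^sub>0 :: "real \<Rightarrow> 'w \<Rightarrow> real"
    and P :: "real \<Rightarrow> real \<Rightarrow> real"
  defines "P \<equiv> \<lambda>l b. outage_probability (\<Omega> l) 0 2 \<infinity> d (K l) (X l) (g l) (g\<^sub>0 l) b"
  assumes "0 < d" "0 < \<beta>" "0 < \<epsilon>" "\<epsilon> < 1"
    and F_range: "\<And>r. 0 \<le> r \<Longrightarrow> F r \<in> {0..1}"
    and F_deriv: "\<And>r. 0 \<le> r \<Longrightarrow> (F has_real_derivative f r) (at r within {0..})"
    and F_nonzero: "\<exists>r\<ge>0. F r \<noteq> 0"
    and F_vanishes: "(F \<longlongrightarrow> 0) at_top"
    and A2_integrable: "set_integrable lborel {0..} (\<lambda>r. f r * ln (r\<^sup>2 + \<beta> * d\<^sup>2))"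
    and network: "\<And>l. 0 < l \<Longrightarrow>
      rayleigh_network (\<Omega> l) (isotropic_intensity l F) (K l) (X l) (g l) (g\<^sub>0 l)"
  shows "(\<lambda>M. capacity_FH P \<beta> M \<epsilon> / capacity_DS P \<beta> M \<epsilon>
            - (1 + pi * F 0 / A2_origin F f (\<beta> * d\<^sup>2) * ln M)) \<in> O[at_top](\<lambda>M. 1)"
proof -
  interpret shape_function F f
    using F_range F_deriv F_nonzero F_vanishes by unfold_locales
  define u where "u = \<beta> * d\<^sup>2"
  have u: "0 < u" using assms by (simp add: u_def)
  have A2: "((\<lambda>r. F r * (2 * r / (r\<^sup>2 + u))) has_integral A2_origin F f u / pi) {0..}"
    using u A2_integrable unfolding u_def by (rule has_integral_A2_origin)
  then have int: "(\<lambda>r. F r * (2 * r / (r\<^sup>2 + u))) integrable_on {0..}" and J_u: "A2_origin F f u = pi * J u"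
    using integral_unique[OF A2] by (auto simp: J_def)
  note int_v = integrable_kernel[OF u int]
  have J_u_pos: "0 < J u"
    using J_pos[OF u int] .
  obtain C where C: "\<And>v. 0 < v \<Longrightarrow> v \<le> u \<Longrightarrow> \<bar>J v + F 0 * ln v\<bar> \<le> C"
    using J_asymptotics[OF u int] by blast
  \<comment> \<open>One formula serves both schemes: direct sequence uses it as it stands, frequency
    hopping with \<open>M = 1\<close> and density \<open>l / M\<close>.\<close>
  have P: "P l (\<beta> / M) = 1 - exp (- (l * (pi * (u / M) * J (u / M))))" if "0 < l" "1 \<le> M" for l M
  proof -
    have "u / M \<le> u" using that u by (simp add: field_simps)
    then show ?thesis
      unfolding P_def
      using outage_probability_rayleigh[OF network[OF \<open>0 < l\<close>] \<open>0 < l\<close>, of "\<beta> / M" d]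
        int_v[of "u / M"] that assms u
      by (simp add: u_def mult_ac)
  qed
  have ratio: "capacity_FH P \<beta> M \<epsilon> / capacity_DS P \<beta> M \<epsilon> = J (u / M) / J u" if M: "1 \<le> M" for M
  proof -
    have J: "0 < J (u / M)"
      using J_antimono[OF u int, of "u / M"] J_u_pos M u by (simp add: field_simps)
    have "max_density (\<lambda>l. P (l / M) \<beta>) \<epsilon> = - ln (1 - \<epsilon>) / (pi * u * J u / M)"
      using P[of _ 1] M u J_u_pos assms by (intro max_density_exp) auto
    moreover have "max_density (\<lambda>l. P l (\<beta> / M)) \<epsilon> = - ln (1 - \<epsilon>) / (pi * (u / M) * J (u / M))"
      using P M u J assms by (intro max_density_exp) auto
    moreover have "ln (1 - \<epsilon>) \<noteq> 0" "1 - \<epsilon> \<noteq> 0"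
      using assms by simp_all
    ultimately show ?thesis
      using M u J J_u_pos by (simp add: capacity_FH_def capacity_DS_def local_capacity_def)
  qed
  show ?thesis
  proof (rule bigoI)
    show "eventually (\<lambda>M. norm (capacity_FH P \<beta> M \<epsilon> / capacity_DS P \<beta> M \<epsilon>
        - (1 + pi * F 0 / A2_origin F f (\<beta> * d\<^sup>2) * ln M)) \<le> (2 * C / J u) * norm (1::real)) at_top"
      using eventually_ge_at_top[of 1]
    proof eventually_elim
      case (elim M)
      \<comment> \<open>The asymptotic bound is applied at \<open>u / M\<close> and at
        \<open>u\<close>. In the difference \<open>F 0 * ln u\<close> cancels and
        \<open>F 0 * ln M\<close> remains, with total error \<open>2 * C\<close>.\<close>
      have "\<bar>J (u / M) + F 0 * ln (u / M)\<bar> \<le> C" "\<bar>J u + F 0 * ln u\<bar> \<le> C"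
        using elim u by (intro C; simp add: field_simps)+
      then have "\<bar>J (u / M) - J u - F 0 * ln M\<bar> \<le> 2 * C"
        using elim u by (simp add: ln_div algebra_simps)
      then have "\<bar>(J (u / M) - J u - F 0 * ln M) / J u\<bar> \<le> 2 * C / J u"
        using J_u_pos by (simp add: divide_right_mono)
      moreover have "J (u / M) / J u - (1 + pi * F 0 / A2_origin F f u * ln M) =
          (J (u / M) - J u - F 0 * ln M) / J u"
        using J_u_pos by (simp add: J_u field_simps)
      ultimately show ?case
        unfolding ratio[OF elim] u_def[symmetric] by simp
    qed
  qed
qed

end
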